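(* Let $(\bar M,g)$ be a Siklos spacetime with defining function $H=H(x_2,x_3,x_4)$ and constant $\beta$, and let $F:M\to\bar M$ be a proper parallel hypersurface whose unit normal is written locally as $$\xi=a\,\partial_1+\frac{x_3}{\beta}\cos\theta\,\partial_3+\frac{x_3}{\beta}\sin\theta\,\partial_4$$ with functions $a,\theta$ on $M$ satisfying $(H''_{33}-H''_{44})\sin(2\theta)=2H''_{34}\cos(2\theta)$ along $M$. Assume that $a=0$. Then there exist local coordinates $(u_1,u_2,u_3)$ on $M$ such that, up to isometries of the ambient space, one of the following holds: (1) there exists a real constant $\theta$ such that the defining function $H$ satisfies the partial differential equation $H'_3=-\tan\theta\, H'_4$ along the hypersurface, and $$F(u_1,u_2,u_3)=\left(u_1,\,u_3,\,\rho e^{u_2},\,-\cot\theta\,\rho e^{u_2}+C\right)$$ for some real constants $C$, $\theta$ and $\rho\neq 0$; or (2) $H''_{32}=H''_{34}=0$ along the hypersurface, and $$F(u_1,u_2,u_3)=(u_1,u_3,C,u_2),$$ where $C\neq 0$ is a real constant. Moreover, both classes of parallel hypersurfaces are of constant mean curvature (CMC).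
   Context: A Siklos spacetime is a 4-dimensional Lorentzian manifold $(\bar M,g)$ with global coordinates $(x_1,x_2,x_3,x_4)$ (where $x_3\neq 0$) and metric $g=\frac{\beta^2}{x_3^2}\left(2dx_1dx_2+H\,dx_2^2+dx_3^2+dx_4^2\right)$, where $H=H(x_2,x_3,x_4)$ is a smooth function (the defining function) and $\beta^2=-3/\Lambda$ with $\Lambda<0$ a real constant. Notation: $\partial_i=\frac{\partial}{\partial x_i}$, $H'_i=\partial_iH$, $H''_{ij}=\partial_i\partial_jH$. In expressions on the hypersurface, $x_3$, $H'_i$, $H''_{ij}$, etc. mean $x_3\circ F$, $H'_i\circ F$, $H''_{ij}\circ F$, etc.; an equation holding "along the hypersurface" means that it holds after composition with $F$. A hypersurface is an isometric immersion $F:M^3\to\bar M^4$ of pseudo-Riemannian manifolds with unit normal $\xi$, $g(\xi,\xi)\in\{-1,1\}$. With $\nabla,\nabla^M$ the Levi-Civita connections of $\bar M,M$, the second fundamental form $h$ is the symmetric $(0,2)$-tensor defined by $\nabla_XY=\nabla^M_XY+h(X,Y)\xi$ for $X,Y$ tangent to $M$. Its covariant derivative is $(\nabla^Mh)(X,Y,Z)=X(h(Y,Z))-h(\nabla^M_XY,Z)-h(Y,\nabla^M_XZ)$. The hypersurface is parallel if $\nabla^Mh=0$, totally geodesic if $h=0$, and proper parallel if it is parallel but not totally geodesic. The mean curvature is $\mathrm{tr}_{g_M}h=\frac13\sum g_M^{ij}h_{ij}$, where $g_M$ is the induced metric on $M$; the hypersurface is of constant mean curvature (CMC) if this function is constant.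 *)

theory Defs
  imports "HOL-Analysis.Analysis"
begin

section \<open>Smooth maps between open subsets of normed spaces\<close>

text \<open>\<open>S\<close> is meant to be open and the source finite-dimensional; continuity of all iterated
  directional derivatives is then the usual notion of class \<open>C\<^sup>k\<close>.\<close>

primrec Ck_on :: "nat \<Rightarrow> ('a::real_normed_vector \<Rightarrow> 'b::real_normed_vector) \<Rightarrow> 'a set \<Rightarrow> bool" where
  "Ck_on 0 f S \<longleftrightarrow> continuous_on S f"
| "Ck_on (Suc k) f S \<longleftrightarrow> (\<forall>x\<in>S. f differentiable (at x)) \<and>
     (\<forall>v. Ck_on k (\<lambda>x. frechet_derivative f (at x) v) S)"

definition smooth_on :: "'a::real_normed_vector set \<Rightarrow> ('a \<Rightarrow> 'b::real_normed_vector) \<Rightarrow> bool" where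
  "smooth_on S f \<longleftrightarrow> (\<forall>k. Ck_on k f S)"

definition coord_deriv :: "'n::finite \<Rightarrow> (real^'n \<Rightarrow> 'b::real_normed_vector) \<Rightarrow> real^'n \<Rightarrow> 'b" where
  "coord_deriv i f x = frechet_derivative f (at x) (axis i 1)"


section \<open>Smooth manifolds\<close>

text \<open>The manifold is the whole (Hausdorff, second countable) type \<open>'m\<close>. A chart is a pair of its
  domain and its coordinate map; the values of the latter outside the domain are irrelevant.\<close>

type_synonym ('m, 'n) chart = "'m set \<times> ('m \<Rightarrow> real^'n)"

definition is_chart :: "('m::topological_space, 'n::finite) chart \<Rightarrow> bool" where
  "is_chart c \<longleftrightarrow> open (fst c) \<and> open (snd c ` fst c) \<and>
     homeomorphism (fst c) (snd c ` fst c) (snd c) (inv_into (fst c) (snd c))"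

definition chart_image :: "('m, 'n) chart \<Rightarrow> (real^'n) set" where
  "chart_image c = snd c ` fst c"

definition in_chart :: "('m, 'n) chart \<Rightarrow> ('m \<Rightarrow> 'b) \<Rightarrow> real^'n \<Rightarrow> 'b" where
  "in_chart c f = f \<circ> inv_into (fst c) (snd c)"

definition smoothly_compatible ::
  "('m::topological_space, 'n::finite) chart \<Rightarrow> ('m, 'n) chart \<Rightarrow> bool" where
  "smoothly_compatible c d \<longleftrightarrow>
     smooth_on (snd c ` (fst c \<inter> fst d)) (in_chart c (snd d)) \<and>
     smooth_on (snd d ` (fst c \<inter> fst d)) (in_chart d (snd c))"

text \<open>A smooth structure is a maximal smooth atlas, so its members are all the local
  coordinate systems of the manifold.\<close>

definition smooth_structure ::
  "('m::{t2_space, second_countable_topology}, 'n::finite) chart set \<Rightarrow> bool" where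
  "smooth_structure A \<longleftrightarrow>
     (\<forall>c\<in>A. is_chart c) \<and>
     (\<Union>c\<in>A. fst c) = UNIV \<and>
     (\<forall>c\<in>A. \<forall>d\<in>A. smoothly_compatible c d) \<and>
     (\<forall>c. is_chart c \<and> (\<forall>d\<in>A. smoothly_compatible c d) \<longrightarrow> c \<in> A)"

definition smooth_map_on ::
  "('m::topological_space, 'n::finite) chart set \<Rightarrow> 'm set \<Rightarrow> ('m \<Rightarrow> 'b::real_normed_vector) \<Rightarrow> bool" where
  "smooth_map_on A W f \<longleftrightarrow> (\<forall>c\<in>A. smooth_on (snd c ` (fst c \<inter> W)) (in_chart c f))"


section \<open>Pseudo-Riemannian metrics in coordinates\<close>

text \<open>A metric on an open subset of \<open>\<real>\<^sup>n\<close> is given by its matrix of components.\<close>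

type_synonym 'n metric = "real^'n \<Rightarrow> real^'n^'n"

definition metric_at :: "'n::finite metric \<Rightarrow> real^'n \<Rightarrow> real^'n \<Rightarrow> real^'n \<Rightarrow> real" where
  "metric_at g x v w = v \<bullet> (g x *v w)"

text \<open>\<open>christoffel g k i j\<close> is the Christoffel symbol with upper index \<open>k\<close> of the Levi-Civita
  connection of \<open>g\<close>.\<close>

definition christoffel :: "'n::finite metric \<Rightarrow> 'n \<Rightarrow> 'n \<Rightarrow> 'n \<Rightarrow> real^'n \<Rightarrow> real" where
  "christoffel g k i j x = (\<Sum>l\<in>UNIV. matrix_inv (g x) $ k $ l *
      (coord_deriv i (\<lambda>y. g y $ j $ l) x + coord_deriv j (\<lambda>y. g y $ i $ l) x
        - coord_deriv l (\<lambda>y. g y $ i $ j) x)) / 2"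

definition pullback_metric ::
  "'k::finite metric \<Rightarrow> (real^'n::finite \<Rightarrow> real^'k) \<Rightarrow> 'n metric" where
  "pullback_metric g f u =
     (\<chi> i j. metric_at g (f u) (coord_deriv i f u) (coord_deriv j f u))"

text \<open>Covariant derivative, in the \<open>i\<close>-th coordinate direction, of a vector field \<open>Y\<close> along the
  map \<open>f\<close>, for the Levi-Civita connection of the metric \<open>g\<close> on the target of \<open>f\<close>.\<close>

definition cov_along ::
  "'k::finite metric \<Rightarrow> (real^'n::finite \<Rightarrow> real^'k) \<Rightarrow> 'n \<Rightarrow> (real^'n \<Rightarrow> real^'k) \<Rightarrow> real^'n \<Rightarrow> real^'k" where
  "cov_along g f i Y u = coord_deriv i Y u +
     (\<chi> k. \<Sum>a\<in>UNIV. \<Sum>b\<in>UNIV. christoffel g k a b (f u) * coord_deriv i f u $ a * Y u $ b)"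

definition ambient_isometry :: "(real^'k::finite) set \<Rightarrow> 'k metric \<Rightarrow> (real^'k \<Rightarrow> real^'k) \<Rightarrow> bool" where
  "ambient_isometry D g \<Phi> \<longleftrightarrow> bij_betw \<Phi> D D \<and> smooth_on D \<Phi> \<and> smooth_on D (inv_into D \<Phi>) \<and>
     (\<forall>x\<in>D. pullback_metric g \<Phi> x = g x)"


section \<open>Hypersurfaces\<close>

text \<open>First the local theory, for a parametrised hypersurface \<open>f\<close> with unit normal \<open>N\<close>. The
  component \<open>h\<^sub>i\<^sub>j\<close> of the second fundamental form is the number determined by the Gauss formula
  for the coordinate fields, \<open>\<nabla>\<^sub>i \<partial>\<^sub>j = \<nabla>\<^sup>M\<^sub>i \<partial>\<^sub>j + h\<^sub>i\<^sub>j N\<close>, with \<open>\<nabla>\<^sup>M\<close> the Levi-Civita connection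
  of the induced metric.\<close>

definition second_ff ::
  "'k::finite metric \<Rightarrow> (real^'n::finite \<Rightarrow> real^'k) \<Rightarrow> (real^'n \<Rightarrow> real^'k) \<Rightarrow> 'n \<Rightarrow> 'n \<Rightarrow> real^'n \<Rightarrow> real" where
  "second_ff g f N i j u = (THE c. cov_along g f i (coord_deriv j f) u =
     (\<Sum>l\<in>UNIV. christoffel (pullback_metric g f) l i j u *\<^sub>R coord_deriv l f u) + c *\<^sub>R N u)"

text \<open>The component \<open>(\<nabla>\<^sup>M h)(\<partial>\<^sub>i, \<partial>\<^sub>j, \<partial>\<^sub>k)\<close>.\<close>

definition cov_second_ff ::
  "'k::finite metric \<Rightarrow> (real^'n::finite \<Rightarrow> real^'k) \<Rightarrow> (real^'n \<Rightarrow> real^'k) \<Rightarrow> 'n \<Rightarrow> 'n \<Rightarrow> 'n \<Rightarrow> real^'n \<Rightarrow> real" where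
  "cov_second_ff g f N i j k u = coord_deriv i (second_ff g f N j k) u
     - (\<Sum>l\<in>UNIV. christoffel (pullback_metric g f) l i j u * second_ff g f N l k u)
     - (\<Sum>l\<in>UNIV. christoffel (pullback_metric g f) l i k u * second_ff g f N j l u)"

definition mean_curv ::
  "'k::finite metric \<Rightarrow> (real^3 \<Rightarrow> real^'k) \<Rightarrow> (real^3 \<Rightarrow> real^'k) \<Rightarrow> real^3 \<Rightarrow> real" where
  "mean_curv g f N u = (1 / 3) *
     (\<Sum>i\<in>UNIV. \<Sum>j\<in>UNIV. matrix_inv (pullback_metric g f u) $ i $ j * second_ff g f N i j u)"

text \<open>An immersion \<open>F\<close> of the 3-manifold with smooth structure \<open>A\<close> into the open set \<open>D\<close> with
  metric \<open>g\<close>, such that the induced metric is nondegenerate, with unit normal \<open>\<xi>\<close>. The metric of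
  the 3-manifold is the induced one, so that \<open>F\<close> is isometric.\<close>

definition hypersurface ::
  "('m::{t2_space, second_countable_topology}, 3) chart set \<Rightarrow> (real^4) set \<Rightarrow> 4 metric \<Rightarrow>
   ('m \<Rightarrow> real^4) \<Rightarrow> ('m \<Rightarrow> real^4) \<Rightarrow> bool" where
  "hypersurface A D g F \<xi> \<longleftrightarrow>
     range F \<subseteq> D \<and> smooth_map_on A UNIV F \<and> smooth_map_on A UNIV \<xi> \<and>
     (\<forall>p. metric_at g (F p) (\<xi> p) (\<xi> p) \<in> {-1, 1}) \<and>
     (\<forall>c\<in>A. \<forall>u\<in>chart_image c.
        inj (frechet_derivative (in_chart c F) (at u)) \<and>
        invertible (pullback_metric g (in_chart c F) u) \<and>
        (\<forall>v. metric_at g (in_chart c F u) (in_chart c \<xi> u)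
               (frechet_derivative (in_chart c F) (at u) v) = 0))"

text \<open>Tensors on the 3-manifold vanish iff their components vanish in every chart.\<close>

definition parallel_hypersurface ::
  "('m, 3) chart set \<Rightarrow> 4 metric \<Rightarrow> ('m \<Rightarrow> real^4) \<Rightarrow> ('m \<Rightarrow> real^4) \<Rightarrow> bool" where
  "parallel_hypersurface A g F \<xi> \<longleftrightarrow> (\<forall>c\<in>A. \<forall>u\<in>chart_image c. \<forall>i j k.
     cov_second_ff g (in_chart c F) (in_chart c \<xi>) i j k u = 0)"

definition totally_geodesic ::
  "('m, 3) chart set \<Rightarrow> 4 metric \<Rightarrow> ('m \<Rightarrow> real^4) \<Rightarrow> ('m \<Rightarrow> real^4) \<Rightarrow> bool" where
  "totally_geodesic A g F \<xi> \<longleftrightarrow> (\<forall>c\<in>A. \<forall>u\<in>chart_image c. \<forall>i j.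
     second_ff g (in_chart c F) (in_chart c \<xi>) i j u = 0)"

definition proper_parallel ::
  "('m, 3) chart set \<Rightarrow> 4 metric \<Rightarrow> ('m \<Rightarrow> real^4) \<Rightarrow> ('m \<Rightarrow> real^4) \<Rightarrow> bool" where
  "proper_parallel A g F \<xi> \<longleftrightarrow> parallel_hypersurface A g F \<xi> \<and> \<not> totally_geodesic A g F \<xi>"

definition constant_mean_curvature ::
  "('m, 3) chart set \<Rightarrow> 4 metric \<Rightarrow> ('m \<Rightarrow> real^4) \<Rightarrow> ('m \<Rightarrow> real^4) \<Rightarrow> bool" where
  "constant_mean_curvature A g F \<xi> \<longleftrightarrow> (\<exists>\<mu>. \<forall>c\<in>A. \<forall>u\<in>chart_image c.
     mean_curv g (in_chart c F) (in_chart c \<xi>) u = \<mu>)"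


section \<open>Siklos spacetimes\<close>

text \<open>A Siklos spacetime is identified, through its global coordinates, with an open set \<open>D\<close> of
  points \<open>x\<close> with \<open>x $ 3 \<noteq> 0\<close>. The index type \<open>4\<close> is cyclic, and the literals 1, 2, 3, 4 denote
  its four distinct elements.\<close>

definition defining_fun :: "(real \<Rightarrow> real \<Rightarrow> real \<Rightarrow> real) \<Rightarrow> real^4 \<Rightarrow> real" where
  "defining_fun H x = H (x $ 2) (x $ 3) (x $ 4)"

definition siklos_metric :: "real \<Rightarrow> (real \<Rightarrow> real \<Rightarrow> real \<Rightarrow> real) \<Rightarrow> 4 metric" where
  "siklos_metric \<beta> H x = (\<beta>\<^sup>2 / (x $ 3)\<^sup>2) *\<^sub>R
     vector [vector [0, 1, 0, 0],
             vector [1, defining_fun H x, 0, 0],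
             vector [0, 0, 1, 0],
             vector [0, 0, 0, 1]]"

definition siklos_spacetime ::
  "(real^4) set \<Rightarrow> real \<Rightarrow> real \<Rightarrow> (real \<Rightarrow> real \<Rightarrow> real \<Rightarrow> real) \<Rightarrow> bool" where
  "siklos_spacetime D \<Lambda> \<beta> H \<longleftrightarrow> open D \<and> (\<forall>x\<in>D. x $ 3 \<noteq> 0) \<and> smooth_on D (defining_fun H) \<and>
     \<Lambda> < 0 \<and> \<beta>\<^sup>2 = - 3 / \<Lambda>"

abbreviation dH :: "(real \<Rightarrow> real \<Rightarrow> real \<Rightarrow> real) \<Rightarrow> 4 \<Rightarrow> real^4 \<Rightarrow> real" where
  "dH H i \<equiv> coord_deriv i (defining_fun H)"

abbreviation ddH :: "(real \<Rightarrow> real \<Rightarrow> real \<Rightarrow> real) \<Rightarrow> 4 \<Rightarrow> 4 \<Rightarrow> real^4 \<Rightarrow> real" where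
  "ddH H i j \<equiv> coord_deriv i (coord_deriv j (defining_fun H))"

lemma vector_4_component:
  "(vector [a, b, c, d] :: 'a::zero^4) $ 1 = a"
  "(vector [a, b, c, d] :: 'a::zero^4) $ 2 = b"
  "(vector [a, b, c, d] :: 'a::zero^4) $ 3 = c"
  "(vector [a, b, c, d] :: 'a::zero^4) $ 4 = d"
  unfolding vector_def by simp_all

lemma siklos_metric_quadratic_form:
  "metric_at (siklos_metric \<beta> H) x v v = \<beta>\<^sup>2 / (x $ 3)\<^sup>2 *
     (2 * v $ 1 * v $ 2 + defining_fun H x * (v $ 2)\<^sup>2 + (v $ 3)\<^sup>2 + (v $ 4)\<^sup>2)"
  unfolding metric_at_def siklos_metric_def
  by (simp add: inner_vec_def matrix_vector_mult_def sum_4 vector_4_component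
      power2_eq_square algebra_simps add_divide_distrib)

end

theory Submission
  imports Defs
begin

text \<open>Write the unit normal as \<open>\<xi> = (x\<^sub>3 / \<beta>) (c \<partial>\<^sub>3 + s \<partial>\<^sub>4)\<close> with \<open>c = cos \<theta>\<close>, \<open>s = sin \<theta>\<close>. The tangent
  spaces are then spanned by \<open>\<partial>\<^sub>1\<close>, \<open>\<partial>\<^sub>2\<close> and \<open>- s \<partial>\<^sub>3 + c \<partial>\<^sub>4\<close>, and the Gauss formula gives
  \<open>h = (c / \<beta>) g - w dx\<^sub>2\<^sup>2\<close> up to a term involving \<open>d\<theta>\<close>, where \<open>w = (\<beta> / 2 x\<^sub>3) (c H\<^sub>3 + s H\<^sub>4)\<close>. Contracting
  \<open>\<nabla>h = 0\<close> with the null field \<open>\<partial>\<^sub>1\<close> shows that \<open>c\<close> is constant; \<open>M\<close> being connected, so is \<open>s\<close>, and \<open>F\<close> lies in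
  a hyperplane \<open>c x\<^sub>3 + s x\<^sub>4 = const\<close>. What remains of \<open>\<nabla>h = 0\<close> is \<open>w = 0\<close> if \<open>s \<noteq> 0\<close>, and \<open>dw = 0\<close>
  if \<open>s = 0\<close>; the case \<open>c = 0\<close> is totally geodesic. The mean curvature is \<open>c / \<beta>\<close> because \<open>dx\<^sub>2\<close> is
  null. The ambient isometry can be taken to be the identity.\<close>

section \<open>Calculus of smooth maps\<close>

text \<open>No angle is ever chosen as a function: its cosine and sine are read off from \<xi> as
  \<beta> \<xi>_3 / x_3 and \<beta> \<xi>_4 / x_3, which are smooth on all of M. The encoding
  imposes two preliminaries. Local coordinates must be members of a maximal atlas, so triples of
  ambient functions are turned into charts by a smooth inverse function theorem. The second
  fundamental form is a definite description, so the Gauss decomposition has to be established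
  before any component can be computed. The dichotomy comes from charts with coordinate fields d_1,
  T, d_2, where T is proportional to - s d_3 + c d_4. Once c and s are constant, h = (c / \<beta>) g
  - w du_3^2. The multiple of g is parallel, and the rest of the 3-2-3 component of \<nabla>h is
  \<Gamma>^3_32 w, with \<Gamma>^3_32 = - T(x_3) / x_3. This factor is nonzero exactly when s is;
  when s = 0, only the differential of w remains. The constants in the parametrizations have direct
  sources: \<rho> is the sign of x_3, which is fixed on connected M, and u_2 = ln |x_3|; C is the
  constant value of c x_3 + s x_4 divided by s or by c.\<close>

lemma Ck_on_cong:
  assumes "open S" "\<And>x. x \<in> S \<Longrightarrow> f x = g x" "Ck_on k f S"
  shows "Ck_on k g S"
  using assms(2,3)
proof (induction k arbitrary: f g)
  case 0
  then show ?case by (simp cong: continuous_on_cong)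
next
  case (Suc k)
  have d: "(g has_derivative frechet_derivative f (at x)) (at x)" if "x \<in> S" for x
    using has_derivative_transform_within_open[of f "frechet_derivative f (at x)" x UNIV S g] Suc.prems that assms(1)
    by (auto simp: frechet_derivative_works)
  have eq: "frechet_derivative g (at x) = frechet_derivative f (at x)" if "x \<in> S" for x
    using frechet_derivative_at[OF d[OF that]] by simp
  have "Ck_on k (\<lambda>x. frechet_derivative g (at x) v) S" for v
    by (rule Suc.IH[of "\<lambda>x. frechet_derivative f (at x) v"]) (use eq Suc.prems in auto)
  then show ?case using d by (auto simp: differentiable_def)
qed

text \<open>Any explicit derivative formula may replace \<open>frechet_derivative\<close>. The
  inductions for products, inverses and compositions run through this rule.\<close>

lemma Ck_on_SucI:
  assumes "open S" "\<And>x. x \<in> S \<Longrightarrow> (f has_derivative f' x) (at x)" "\<And>v. Ck_on k (\<lambda>x. f' x v) S"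
  shows "Ck_on (Suc k) f S"
proof -
  have "frechet_derivative f (at x) = f' x" if "x \<in> S" for x
    using frechet_derivative_at[OF assms(2)[OF that]] by simp
  then have "Ck_on k (\<lambda>x. frechet_derivative f (at x) v) S" for v
    using Ck_on_cong[OF assms(1) _ assms(3)[of v]] by simp
  then show ?thesis using assms(2) by (auto simp: differentiable_def)
qed

lemma Ck_on_has_derivative:
  "Ck_on (Suc k) f S \<Longrightarrow> x \<in> S \<Longrightarrow> (f has_derivative frechet_derivative f (at x)) (at x)"
  by (simp add: frechet_derivative_works)

lemma Ck_on_subset: "T \<subseteq> S \<Longrightarrow> Ck_on k f S \<Longrightarrow> Ck_on k f T"
  by (induction k arbitrary: f) (auto intro: continuous_on_subset)

lemma Ck_on_SucD: "Ck_on (Suc k) f S \<Longrightarrow> Ck_on k f S"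
proof (induction k arbitrary: f)
  case 0
  then show ?case
    by (auto intro!: continuous_at_imp_continuous_on differentiable_imp_continuous_within)
next
  case (Suc k)
  then show ?case by (metis Ck_on.simps(2))
qed

lemma Ck_on_imp_continuous_on: "Ck_on k f S \<Longrightarrow> continuous_on S f"
  by (induction k) (simp, blast dest: Ck_on_SucD)

lemma Ck_on_const [intro]: "open S \<Longrightarrow> Ck_on k (\<lambda>x. c) S"
  by (induction k arbitrary: c) auto

lemma Ck_on_bounded_linear:
  assumes "open S" "bounded_linear L" "Ck_on k f S"
  shows "Ck_on k (\<lambda>x. L (f x)) S"
  using assms(3)
proof (induction k arbitrary: f)
  case 0
  then show ?case using assms(2) by (simp add: bounded_linear.continuous_on)
next
  case (Suc k)
  show ?case
    by (rule Ck_on_SucI[OF assms(1) bounded_linear.has_derivative[OF assms(2) Ck_on_has_derivative[OF Suc.prems]]])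
      (use Suc in \<open>auto intro: assms(1)\<close>)
qed

lemma Ck_on_add:
  assumes "open S" "Ck_on k f S" "Ck_on k g S"
  shows "Ck_on k (\<lambda>x. f x + g x) S"
  using assms(2,3)
proof (induction k arbitrary: f g)
  case 0
  then show ?case by (simp add: continuous_on_add)
next
  case (Suc k)
  show ?case
    by (rule Ck_on_SucI[OF assms(1) has_derivative_add[OF Suc.prems[THEN Ck_on_has_derivative]]])
      (use Suc in \<open>auto intro: assms(1)\<close>)
qed

lemma Ck_on_sum:
  assumes "open S" "\<And>i. i \<in> I \<Longrightarrow> Ck_on k (f i) S"
  shows "Ck_on k (\<lambda>x. \<Sum>i\<in>I. f i x) S"
  using assms(2)
  by (induction I rule: infinite_finite_induct) (auto intro!: Ck_on_add Ck_on_const assms(1))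

text \<open>The product rule pairs a differentiated factor with an undifferentiated one, so the
  induction also needs the factors themselves in the lower class; hence \<open>Ck_on_SucD\<close>.
  The bilinear form covers scalar multiples and real products at once.\<close>

lemma (in bounded_bilinear) Ck_on:
  assumes "open S" "Ck_on k f S" "Ck_on k g S"
  shows "Ck_on k (\<lambda>x. prod (f x) (g x)) S"
  using assms(2,3)
proof (induction k arbitrary: f g)
  case 0
  then show ?case by (simp add: continuous_on)
next
  case (Suc k)
  note f = Suc.prems(1) and g = Suc.prems(2)
  show ?case
    by (rule Ck_on_SucI[OF assms(1) FDERIV[OF f[THEN Ck_on_has_derivative] g[THEN Ck_on_has_derivative]]])
      (use Suc.IH f g f[THEN Ck_on_SucD] g[THEN Ck_on_SucD] in \<open>auto intro!: Ck_on_add assms(1)\<close>)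
qed

lemmas Ck_on_scaleR = bounded_bilinear.Ck_on[OF bounded_bilinear_scaleR]
lemmas Ck_on_mult = bounded_bilinear.Ck_on[OF bounded_bilinear_mult]
lemmas Ck_on_vec_nth = Ck_on_bounded_linear[OF _ bounded_linear_vec_nth]

lemma Ck_on_uminus: "open S \<Longrightarrow> Ck_on k f S \<Longrightarrow> Ck_on k (\<lambda>x. - f x) S"
  by (rule Ck_on_bounded_linear[OF _ bounded_linear_minus[OF bounded_linear_ident]])

lemma Ck_on_prod:
  fixes f :: "'i \<Rightarrow> 'a::real_normed_vector \<Rightarrow> real"
  assumes "open S" "\<And>i. i \<in> I \<Longrightarrow> Ck_on k (f i) S"
  shows "Ck_on k (\<lambda>x. \<Prod>i\<in>I. f i x) S"
  using assms(2)
  by (induction I rule: infinite_finite_induct) (auto intro!: Ck_on_mult Ck_on_const assms(1))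

text \<open>The derivative of 1/f is -(1/f) f' (1/f), so the induction hypothesis for 1/f itself,
  with \<open>f\<close> fixed, closes the step.\<close>

lemma Ck_on_inverse:
  fixes f :: "'a::real_normed_vector \<Rightarrow> real"
  assumes "open S" "\<And>x. x \<in> S \<Longrightarrow> f x \<noteq> 0" "Ck_on k f S"
  shows "Ck_on k (\<lambda>x. inverse (f x)) S"
  using assms(3)
proof (induction k)
  case 0
  then show ?case using assms(2) by (auto intro: continuous_on_inverse)
next
  case (Suc k)
  note d = Ck_on_has_derivative[OF Suc.prems]
  show ?case
    by (rule Ck_on_SucI[OF assms(1) Deriv.has_derivative_inverse[OF assms(2) d]])
      (use Suc.IH Suc.prems Ck_on_SucD[OF Suc.prems] in \<open>auto intro!: Ck_on_mult Ck_on_uminus assms(1)\<close>)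
qed

lemma Ck_on_divide:
  fixes f :: "'a::real_normed_vector \<Rightarrow> real"
  assumes "open S" "Ck_on k f S" "Ck_on k g S" "\<And>x. x \<in> S \<Longrightarrow> g x \<noteq> 0"
  shows "Ck_on k (\<lambda>x. f x / g x) S"
  unfolding divide_inverse using assms by (intro Ck_on_mult Ck_on_inverse)

lemma Ck_on_vec_lambda:
  fixes f :: "'n::finite \<Rightarrow> 'a::real_normed_vector \<Rightarrow> real"
  assumes "open S" "\<And>i. Ck_on k (f i) S"
  shows "Ck_on k (\<lambda>x. \<chi> i. f i x) S"
proof -
  have "(\<chi> i. f i x) = (\<Sum>i\<in>UNIV. f i x *\<^sub>R axis i 1)" for x
    using basis_expansion[of "\<chi> i. f i x"] by (simp add: scalar_mult_eq_scaleR)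
  then show ?thesis
    using Ck_on_sum[of S UNIV k "\<lambda>i x. f i x *\<^sub>R axis i 1"] assms
    by (simp add: Ck_on_scaleR Ck_on_const)
qed

lemma Ck_on_det:
  fixes M :: "'a::real_normed_vector \<Rightarrow> real^'n^'n"
  assumes "open S" "\<And>i j. Ck_on k (\<lambda>x. M x $ i $ j) S"
  shows "Ck_on k (\<lambda>x. det (M x)) S"
  unfolding det_def by (intro Ck_on_sum Ck_on_mult Ck_on_const Ck_on_prod assms)

lemma linear_eq_sum_Basis:
  assumes "linear L"
  shows "L v = (\<Sum>b\<in>Basis. (v \<bullet> b) *\<^sub>R L b)"
proof -
  have "L v = L (\<Sum>b\<in>Basis. (v \<bullet> b) *\<^sub>R b)" by (simp add: euclidean_representation)
  also have "\<dots> = (\<Sum>b\<in>Basis. (v \<bullet> b) *\<^sub>R L b)"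
    using assms by (simp add: linear_sum linear_scale)
  finally show ?thesis .
qed

text \<open>The class is defined through derivatives in fixed directions, but the chain rule
  evaluates Dg in the moving direction Df(x) v. Expanding that direction over \<open>Basis\<close>
  separates a scalar C^k coefficient from Dg in a fixed direction, which is why the intermediate
  space is Euclidean.\<close>

lemma Ck_on_compose:
  fixes g :: "'b::euclidean_space \<Rightarrow> 'c::real_normed_vector"
  assumes "open S" "f ` S \<subseteq> T" "Ck_on k g T" "Ck_on k f S"
  shows "Ck_on k (\<lambda>x. g (f x)) S"
  using assms(3,4)
proof (induction k arbitrary: g)
  case 0
  then show ?case using assms(2) by (auto intro: continuous_on_compose2)
next
  case (Suc k)
  note f = Ck_on_has_derivative[OF Suc.prems(2)] and g = Ck_on_has_derivative[OF Suc.prems(1)]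
  have d: "((\<lambda>x. g (f x)) has_derivative
      (\<lambda>v. \<Sum>b\<in>Basis. (frechet_derivative f (at x) v \<bullet> b) *\<^sub>R frechet_derivative g (at (f x)) b)) (at x)"
    if "x \<in> S" for x
  proof -
    have "f x \<in> T" using that assms(2) by auto
    note g = g[OF this]
    have "frechet_derivative g (at (f x)) (frechet_derivative f (at x) v) =
      (\<Sum>b\<in>Basis. (frechet_derivative f (at x) v \<bullet> b) *\<^sub>R frechet_derivative g (at (f x)) b)" for v
      by (rule linear_eq_sum_Basis[OF has_derivative_linear[OF g]])
    then show ?thesis using has_derivative_compose[OF f[OF that] g] by presburger
  qed
  have "Ck_on k (\<lambda>x. (frechet_derivative f (at x) v \<bullet> b) *\<^sub>R frechet_derivative g (at (f x)) b) S" for v b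
  proof (rule Ck_on_scaleR[OF assms(1)])
    show "Ck_on k (\<lambda>x. frechet_derivative f (at x) v \<bullet> b) S"
      by (rule Ck_on_bounded_linear[OF assms(1) bounded_linear_inner_left]) (use Suc.prems(2) in simp)
    show "Ck_on k (\<lambda>x. frechet_derivative g (at (f x)) b) S"
      by (rule Suc.IH) (use Suc.prems(1) Ck_on_SucD[OF Suc.prems(2)] in simp_all)
  qed
  then have "Ck_on k (\<lambda>x. \<Sum>b\<in>Basis. (frechet_derivative f (at x) v \<bullet> b) *\<^sub>R
      frechet_derivative g (at (f x)) b) S" for v
    by (rule Ck_on_sum[OF assms(1)])
  with d show ?case by (rule Ck_on_SucI[OF assms(1)])
qed

lemma Ck_on_ident: "open S \<Longrightarrow> Ck_on k (\<lambda>x. x) S"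
proof (cases k)
  case (Suc k')
  assume S: "open S"
  show ?thesis unfolding Suc
    by (rule Ck_on_SucI[OF S has_derivative_ident Ck_on_const[OF S]])
qed simp

lemma Ck_on_ln: "Ck_on k (ln :: real \<Rightarrow> real) {0<..}"
proof (cases k)
  case (Suc k')
  show ?thesis unfolding Suc
  proof (rule Ck_on_SucI)
    show "(ln has_derivative (\<lambda>v. v * inverse x)) (at x)" if "x \<in> {0<..}" for x :: real
      using that DERIV_ln[of x] by (simp add: has_field_derivative_def mult_commute_abs)
    show "Ck_on k' (\<lambda>x. v * inverse x) {0<..}" for v :: real
      by (rule Ck_on_mult[OF _ Ck_on_const Ck_on_inverse[OF _ _ Ck_on_ident]]) auto
  qed simp
qed (auto intro!: continuous_intros)

lemma frechet_derivative_eq: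
  "(f has_derivative f') (at x) \<Longrightarrow> frechet_derivative f (at x) = f'"
  by (metis frechet_derivative_at)

section \<open>Closure rules for smooth maps\<close>

lemma smooth_on_subset: "T \<subseteq> S \<Longrightarrow> smooth_on S f \<Longrightarrow> smooth_on T f"
  by (auto simp: smooth_on_def intro: Ck_on_subset)

lemma smooth_on_cong: "open S \<Longrightarrow> (\<And>x. x \<in> S \<Longrightarrow> f x = g x) \<Longrightarrow> smooth_on S f \<Longrightarrow> smooth_on S g"
  by (auto simp: smooth_on_def intro: Ck_on_cong)

lemma smooth_on_compose:
  fixes g :: "'b::euclidean_space \<Rightarrow> 'c::real_normed_vector"
  assumes "open S" "f ` S \<subseteq> T" "smooth_on T g" "smooth_on S f"
  shows "smooth_on S (\<lambda>x. g (f x))"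
  using assms unfolding smooth_on_def by (blast intro: Ck_on_compose)

lemma smooth_on_frechet_derivative: "smooth_on S f \<Longrightarrow> smooth_on S (\<lambda>x. frechet_derivative f (at x) v)"
  unfolding smooth_on_def
proof
  fix k assume "\<forall>k. Ck_on k f S"
  then have "Ck_on (Suc k) f S" ..
  then show "Ck_on k (\<lambda>x. frechet_derivative f (at x) v) S" by simp
qed

lemma smooth_on_has_derivative:
  "smooth_on S f \<Longrightarrow> x \<in> S \<Longrightarrow> (f has_derivative frechet_derivative f (at x)) (at x)"
  unfolding smooth_on_def using Ck_on_has_derivative by blast

lemma smooth_on_imp_continuous_on: "smooth_on S f \<Longrightarrow> continuous_on S f"
  unfolding smooth_on_def by (metis Ck_on_imp_continuous_on)

lemma smooth_on_coord_deriv: "smooth_on S f \<Longrightarrow> smooth_on S (coord_deriv i f)"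
  using smooth_on_frechet_derivative[of S f "axis i 1"] by (simp add: coord_deriv_def[abs_def])

lemma smooth_on_const: "open S \<Longrightarrow> smooth_on S (\<lambda>x. c)"
  by (auto simp: smooth_on_def)

lemma smooth_on_vec_nth: "open S \<Longrightarrow> smooth_on S f \<Longrightarrow> smooth_on S (\<lambda>x. f x $ i)"
  by (auto simp: smooth_on_def Ck_on_vec_nth)

lemma smooth_on_add: "open S \<Longrightarrow> smooth_on S f \<Longrightarrow> smooth_on S g \<Longrightarrow> smooth_on S (\<lambda>x. f x + g x)"
  by (auto simp: smooth_on_def Ck_on_add)

lemma smooth_on_mult:
  fixes f g :: "_ \<Rightarrow> real"
  shows "open S \<Longrightarrow> smooth_on S f \<Longrightarrow> smooth_on S g \<Longrightarrow> smooth_on S (\<lambda>x. f x * g x)"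
  by (auto simp: smooth_on_def Ck_on_mult)

lemma smooth_on_divide:
  fixes f g :: "_ \<Rightarrow> real"
  shows "open S \<Longrightarrow> smooth_on S f \<Longrightarrow> smooth_on S g \<Longrightarrow> (\<And>x. x \<in> S \<Longrightarrow> g x \<noteq> 0) \<Longrightarrow>
    smooth_on S (\<lambda>x. f x / g x)"
  by (auto simp: smooth_on_def Ck_on_divide)

lemma smooth_on_vec_lambda:
  fixes f :: "'n::finite \<Rightarrow> 'a::real_normed_vector \<Rightarrow> real"
  shows "open S \<Longrightarrow> (\<And>i. smooth_on S (f i)) \<Longrightarrow> smooth_on S (\<lambda>x. \<chi> i. f i x)"
  by (auto simp: smooth_on_def Ck_on_vec_lambda)

lemma smooth_on_ident: "open S \<Longrightarrow> smooth_on S (\<lambda>x. x)"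
  by (auto simp: smooth_on_def Ck_on_ident)

lemma smooth_on_ln: "open S \<Longrightarrow> smooth_on S f \<Longrightarrow> (\<And>x. x \<in> S \<Longrightarrow> f x > 0) \<Longrightarrow> smooth_on S (\<lambda>x. ln (f x :: real))"
  by (rule smooth_on_compose[of S f "{0<..}"]) (auto simp: smooth_on_def Ck_on_ln)

subsection \<open>The smooth inverse function theorem\<close>

text \<open>Bootstrapping: if \<open>g\<close> is C^k, so are the entries of the Jacobian of
  \<open>f\<close> along \<open>g\<close>. Cramer's rule writes g' as quotients of determinants in
  these entries, so g' is C^k and \<open>g\<close> is C^(k+1).\<close>

lemma smooth_on_local_inverse:
  fixes f :: "real^'n::finite \<Rightarrow> real^'n"
  assumes f: "smooth_on S f" and V: "open V" and gV: "g ` V \<subseteq> S"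
    and g: "\<And>y. y \<in> V \<Longrightarrow> (g has_derivative g' y) (at y)"
    and fg: "\<And>y v. y \<in> V \<Longrightarrow> frechet_derivative f (at (g y)) (g' y v) = v"
  shows "smooth_on V g"
  unfolding smooth_on_def
proof
  fix k show "Ck_on k g V"
  proof (induction k)
    case 0
    show ?case using g by (auto intro!: continuous_at_imp_continuous_on has_derivative_continuous)
  next
    case (Suc k)
    let ?M = "\<lambda>y. matrix (frechet_derivative f (at (g y)))"
    have M: "Ck_on k (\<lambda>y. ?M y $ i $ j) V" for i j
    proof -
      have "Ck_on k (\<lambda>y. frechet_derivative f (at (g y)) (axis j 1)) V"
        by (rule Ck_on_compose[OF V gV _ Suc, of "\<lambda>y. frechet_derivative f (at y) (axis j 1)"])
          (use smooth_on_frechet_derivative[OF f] in \<open>auto simp: smooth_on_def\<close>)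
      then show ?thesis by (simp add: matrix_def Ck_on_vec_nth V)
    qed
    have lin: "linear (frechet_derivative f (at (g y)))" if "y \<in> V" for y
      using smooth_on_has_derivative[OF f] gV that has_derivative_linear by blast
    have det: "det (?M y) \<noteq> 0" if "y \<in> V" for y
    proof -
      have "surj (frechet_derivative f (at (g y)))" using fg[OF that] by (metis surjI)
      then show ?thesis
        using det_nz_iff_inj[OF lin[OF that]] linear_surjective_imp_injective[OF lin[OF that]] by simp
    qed
    have g'v: "g' y v = (\<chi> k. det (\<chi> i j. if j = k then v $ i else ?M y $ i $ j) / det (?M y))"
      if "y \<in> V" for y v
      using cramer[OF det[OF that], of "g' y v" v] fg[OF that] matrix_vector_mul(1)[of "frechet_derivative f (at (g y))"] lin[OF that]
      by (simp add: linear_matrix_vector_mul_eq)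
    have M': "Ck_on k (\<lambda>y. if j = l then v $ i else ?M y $ i $ j) V" for l v i j
      by (cases "j = l") (simp_all add: Ck_on_const V M)
    have "Ck_on k (\<lambda>y. \<chi> l. det (\<chi> i j. if j = l then v $ i else ?M y $ i $ j) / det (?M y)) V" for v
    proof (rule Ck_on_vec_lambda[OF V], rule Ck_on_divide[OF V])
      show "Ck_on k (\<lambda>y. det (\<chi> i j. if j = l then v $ i else ?M y $ i $ j)) V" for l
        by (rule Ck_on_det[OF V]) (simp only: vec_lambda_beta M')
      show "Ck_on k (\<lambda>y. det (?M y)) V" by (rule Ck_on_det[OF V M])
    qed (rule det)
    then have "Ck_on k (\<lambda>y. g' y v) V" for v
      by (rule Ck_on_cong[OF V g'v[symmetric], rotated])
    with g show ?case by (rule Ck_on_SucI[OF V])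
  qed
qed

text \<open>The C^1 inverse function theorem wants the derivative as a continuous map into bounded
  linear operators, so \<open>f'\<close> repackages it in that form. The smoothness of the inverse
  is then a matter of bootstrapping.\<close>

lemma smooth_inverse_function:
  fixes f :: "real^'n::finite \<Rightarrow> real^'n"
  assumes "open S" "smooth_on S f" "x \<in> S" "inj (frechet_derivative f (at x))"
  obtains U V g where "open U" "U \<subseteq> S" "x \<in> U" "open V" "homeomorphism U V f g" "smooth_on V g"
proof -
  define f' where "f' = (\<lambda>x. Blinfun (frechet_derivative f (at x)))"
  have f': "blinfun_apply (f' x) = frechet_derivative f (at x)" if "x \<in> S" for x
    unfolding f'_def
    by (rule bounded_linear_Blinfun_apply[OF has_derivative_bounded_linear[OF smooth_on_has_derivative[OF assms(2) that]]])
  have lin: "linear (frechet_derivative f (at x))"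
    using smooth_on_has_derivative[OF assms(2,3)] has_derivative_linear by blast
  obtain L where L: "linear L" "L \<circ> frechet_derivative f (at x) = id"
    using linear_injective_left_inverse[OF lin assms(4)] by blast
  have L': "blinfun_apply (Blinfun L) = L"
    using L(1) by (simp add: bounded_linear_Blinfun_apply linear_conv_bounded_linear)
  have inv: "Blinfun L o\<^sub>L f' x = id_blinfun"
    by (rule blinfun_eqI) (use L(2) L' f'[OF assms(3)] in \<open>simp add: fun_eq_iff\<close>)
  have cont: "continuous_on S f'"
    by (rule continuous_on_blinfun_componentwise)
      (use f' smooth_on_imp_continuous_on[OF smooth_on_frechet_derivative[OF assms(2)]] in \<open>simp cong: continuous_on_cong\<close>)
  have der: "(f has_derivative blinfun_apply (f' x)) (at x)" if "x \<in> S" for x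
    using smooth_on_has_derivative[OF assms(2) that] f'[OF that] by simp
  obtain U V g g' where *: "open U" "U \<subseteq> S" "x \<in> U" "open V" "f x \<in> V" "homeomorphism U V f g"
    "\<And>y. y \<in> V \<Longrightarrow> (g has_derivative (g' y)) (at y)"
    "\<And>y. y \<in> V \<Longrightarrow> g' y = inv (blinfun_apply (f'(g y)))"
    "\<And>y. y \<in> V \<Longrightarrow> bij (blinfun_apply (f'(g y)))"
    using inverse_function_theorem[OF assms(1) der cont assms(3) inv] by metis
  have gV: "g ` V \<subseteq> S" using * homeomorphism_image2[OF *(6)] by blast
  have "smooth_on V g"
  proof (rule smooth_on_local_inverse[OF assms(2) *(4) gV *(7)])
    show "frechet_derivative f (at (g y)) (g' y v) = v" if "y \<in> V" for y v
      using *(8,9)[OF that] f'[of "g y"] gV that by (auto simp: bij_is_surj surj_f_inv_f)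
  qed
  then show ?thesis using that * by blast
qed

subsection \<open>Symmetry of second derivatives\<close>

lemma smooth_has_line_derivative:
  fixes f :: "'a::real_normed_vector \<Rightarrow> real"
  assumes "smooth_on S f" "x + s *\<^sub>R v \<in> S"
  shows "((\<lambda>s. f (x + s *\<^sub>R v)) has_real_derivative frechet_derivative f (at (x + s *\<^sub>R v)) v) (at s)"
proof -
  have d: "((\<lambda>s. x + s *\<^sub>R v) has_derivative (\<lambda>t. t *\<^sub>R v)) (at s)" by (auto intro!: derivative_eq_intros)
  note h = smooth_on_has_derivative[OF assms]
  show ?thesis
    using has_derivative_compose[OF d h] linear_scale[OF has_derivative_linear[OF h]]
    by (simp add: has_field_derivative_def mult_commute_abs)
qed

text \<open>Two mean value theorems: the second difference over the parallelogram is the increment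
  of \<open>?\<phi>\<close> along \<open>v\<close>, and the derivative of \<open>?\<phi>\<close> is
  in turn an increment along \<open>w\<close> of the derivative in direction
  \<open>v\<close>.\<close>

lemma second_difference_mean_value:
  fixes f :: "'a::real_normed_vector \<Rightarrow> real"
  assumes f: "smooth_on S f" and t: "t > 0"
    and S: "\<And>a b. 0 \<le> a \<Longrightarrow> a \<le> t \<Longrightarrow> 0 \<le> b \<Longrightarrow> b \<le> t \<Longrightarrow> x + a *\<^sub>R v + b *\<^sub>R w \<in> S"
  obtains a b where "0 < a" "a < t" "0 < b" "b < t"
    "f (x + t *\<^sub>R v + t *\<^sub>R w) - f (x + t *\<^sub>R v) - f (x + t *\<^sub>R w) + f x =
      t * t * frechet_derivative (\<lambda>y. frechet_derivative f (at y) v) (at (x + a *\<^sub>R v + b *\<^sub>R w)) w"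
proof -
  let ?\<phi> = "\<lambda>a. f (x + t *\<^sub>R w + a *\<^sub>R v) - f (x + a *\<^sub>R v)"
  let ?d = "\<lambda>y. frechet_derivative f (at y) v"
  have in1: "x + t *\<^sub>R w + a *\<^sub>R v \<in> S" "x + a *\<^sub>R v \<in> S" if "0 \<le> a" "a \<le> t" for a
    using S[of a t] S[of a 0] that t by (auto simp: algebra_simps)
  have "\<exists>a>0. a < t \<and> ?\<phi> t - ?\<phi> 0 = (t - 0) * (?d (x + t *\<^sub>R w + a *\<^sub>R v) - ?d (x + a *\<^sub>R v))"
    by (rule MVT2[OF t]) (intro DERIV_diff smooth_has_line_derivative[OF f] in1)
  then obtain a where a: "0 < a" "a < t"
    "?\<phi> t - ?\<phi> 0 = (t - 0) * (?d (x + t *\<^sub>R w + a *\<^sub>R v) - ?d (x + a *\<^sub>R v))" by blast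
  have in2: "x + a *\<^sub>R v + b *\<^sub>R w \<in> S" if "0 \<le> b" "b \<le> t" for b using S that a by simp
  have "\<exists>b>0. b < t \<and> ?d (x + a *\<^sub>R v + t *\<^sub>R w) - ?d (x + a *\<^sub>R v + 0 *\<^sub>R w) =
      (t - 0) * frechet_derivative ?d (at (x + a *\<^sub>R v + b *\<^sub>R w)) w"
    by (rule MVT2[OF t]) (intro smooth_has_line_derivative[OF smooth_on_frechet_derivative[OF f]] in2)
  then obtain b where b: "0 < b" "b < t" "?d (x + a *\<^sub>R v + t *\<^sub>R w) - ?d (x + a *\<^sub>R v + 0 *\<^sub>R w) =
      (t - 0) * frechet_derivative ?d (at (x + a *\<^sub>R v + b *\<^sub>R w)) w" by blast
  have "f (x + t *\<^sub>R v + t *\<^sub>R w) - f (x + t *\<^sub>R v) - f (x + t *\<^sub>R w) + f x = ?\<phi> t - ?\<phi> 0"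
    by (simp add: add.commute add.left_commute)
  also have "\<dots> = t * (?d (x + a *\<^sub>R v + t *\<^sub>R w) - ?d (x + a *\<^sub>R v + 0 *\<^sub>R w))"
    using a(3) by (simp add: add.commute add.left_commute)
  finally show ?thesis using that[OF a(1,2) b(1,2)] b(3) by simp
qed

text \<open>The second difference is symmetric in \<open>v\<close> and \<open>w\<close>, so both
  mixed derivatives represent it at points near \<open>x\<close>; their continuity forbids a gap
  between them at \<open>x\<close>.\<close>

lemma frechet_derivative_symmetric:
  fixes f :: "'a::real_normed_vector \<Rightarrow> real"
  assumes "open S" "smooth_on S f" "x \<in> S"
  shows "frechet_derivative (\<lambda>y. frechet_derivative f (at y) v) (at x) w =
    frechet_derivative (\<lambda>y. frechet_derivative f (at y) w) (at x) v"
proof (rule ccontr)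
  let ?d = "\<lambda>v w y. frechet_derivative (\<lambda>y. frechet_derivative f (at y) v) (at y) w"
  assume neq: "\<not> ?thesis"
  \<comment> \<open>Half the gap: values within \<open>e\<close> of two numbers at distance 2e
    cannot coincide.\<close>
  define e where "e = \<bar>?d v w x - ?d w v x\<bar> / 2"
  have e: "e > 0" using neq by (simp add: e_def)
  have cont: "isCont (?d v w) x" for v w
  proof -
    have "continuous_on S (?d v w)"
      by (intro smooth_on_imp_continuous_on smooth_on_frechet_derivative assms(2))
    then show ?thesis using continuous_on_eq_continuous_at[OF assms(1)] assms(3) by blast
  qed
  obtain r1 where r1: "r1 > 0" "\<And>y. dist y x < r1 \<Longrightarrow> dist (?d v w y) (?d v w x) < e"
    using cont[of v w] e unfolding continuous_at_eps_delta by blast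
  obtain r2 where r2: "r2 > 0" "\<And>y. dist y x < r2 \<Longrightarrow> dist (?d w v y) (?d w v x) < e"
    using cont[of w v] e unfolding continuous_at_eps_delta by blast
  obtain r3 where r3: "r3 > 0" "ball x r3 \<subseteq> S" using assms open_contains_ball by blast
  define r where "r = min r1 (min r2 r3)"
  have r: "r > 0" using r1 r2 r3 by (simp add: r_def)
  \<comment> \<open>Small enough for the whole parallelogram with sides t v and t w to lie within
    \<open>r\<close> of \<open>x\<close>; the summand 1 keeps the denominator positive when both
    vectors vanish.\<close>
  define t where "t = r / (2 * (1 + norm v + norm w))"
  have pos: "1 + norm v + norm w > 0" by (smt (verit) norm_ge_zero)
  have t: "t > 0" using r pos by (simp add: t_def)
  have near: "dist (x + a *\<^sub>R v + b *\<^sub>R w) x < r" if "0 \<le> a" "a \<le> t" "0 \<le> b" "b \<le> t" for a b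
  proof -
    have "dist (x + a *\<^sub>R v + b *\<^sub>R w) x = norm (a *\<^sub>R v + b *\<^sub>R w)" by (simp add: dist_norm add.assoc)
    also have "\<dots> \<le> a * norm v + b * norm w"
      using norm_triangle_ineq[of "a *\<^sub>R v" "b *\<^sub>R w"] that by simp
    also have "\<dots> \<le> t * norm v + t * norm w" using that by (intro add_mono mult_right_mono) auto
    also have "\<dots> < t * (2 * (1 + norm v + norm w))"
      using t pos mult_pos_pos[OF t pos] by (simp add: algebra_simps)
    also have "\<dots> = r" using pos by (simp add: t_def)
    finally show ?thesis .
  qed
  have inS: "x + a *\<^sub>R v + b *\<^sub>R w \<in> S" "x + b *\<^sub>R w + a *\<^sub>R v \<in> S" if "0 \<le> a" "a \<le> t" "0 \<le> b" "b \<le> t" for a b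
  proof -
    have "x + a *\<^sub>R v + b *\<^sub>R w \<in> ball x r3" using near[OF that] by (simp add: r_def dist_commute)
    then show "x + a *\<^sub>R v + b *\<^sub>R w \<in> S" using r3(2) by blast
    then show "x + b *\<^sub>R w + a *\<^sub>R v \<in> S" by (simp add: add.commute add.left_commute)
  qed
  obtain a b where ab: "0 < a" "a < t" "0 < b" "b < t"
    "f (x + t *\<^sub>R v + t *\<^sub>R w) - f (x + t *\<^sub>R v) - f (x + t *\<^sub>R w) + f x = t * t * ?d v w (x + a *\<^sub>R v + b *\<^sub>R w)"
    by (rule second_difference_mean_value[OF assms(2) t inS(1)])
  obtain b' a' where ab': "0 < b'" "b' < t" "0 < a'" "a' < t"
    "f (x + t *\<^sub>R w + t *\<^sub>R v) - f (x + t *\<^sub>R w) - f (x + t *\<^sub>R v) + f x = t * t * ?d w v (x + b' *\<^sub>R w + a' *\<^sub>R v)"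
    by (rule second_difference_mean_value[OF assms(2) t inS(2)])
  have "t * t * ?d v w (x + a *\<^sub>R v + b *\<^sub>R w) = t * t * ?d w v (x + b' *\<^sub>R w + a' *\<^sub>R v)"
    using ab(5) ab'(5) by (simp add: algebra_simps)
  then have eq: "?d v w (x + a *\<^sub>R v + b *\<^sub>R w) = ?d w v (x + b' *\<^sub>R w + a' *\<^sub>R v)" using t by simp
  have "dist (?d v w (x + a *\<^sub>R v + b *\<^sub>R w)) (?d v w x) < e"
    using near[of a b] ab by (intro r1(2)) (auto simp: r_def)
  moreover have "dist (?d w v (x + b' *\<^sub>R w + a' *\<^sub>R v)) (?d w v x) < e"
    using near[of a' b'] ab' by (intro r2(2)) (auto simp: r_def add.commute add.left_commute)
  ultimately show False using eq unfolding e_def dist_real_def by argo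
qed

lemma coord_deriv_symmetric:
  fixes f :: "real^'n::finite \<Rightarrow> real"
  assumes "open S" "smooth_on S f" "x \<in> S"
  shows "coord_deriv i (coord_deriv j f) x = coord_deriv j (coord_deriv i f) x"
  using frechet_derivative_symmetric[OF assms] by (simp add: coord_deriv_def[abs_def])

section \<open>Charts\<close>

lemma open_chart_image_Int:
  assumes "is_chart c" "open T"
  shows "open (snd c ` (fst c \<inter> T))"
proof -
  have "openin (top_of_set (snd c ` fst c)) (snd c ` (fst c \<inter> T))"
    using assms unfolding is_chart_def
    by (intro homeomorphism_imp_open_map[of "fst c" _ "snd c"]) (auto simp: openin_open_Int)
  then show ?thesis using assms by (simp add: is_chart_def openin_open_eq)
qed

lemma open_chart_image: "is_chart c \<Longrightarrow> open (chart_image c)"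
  by (simp add: chart_image_def is_chart_def)

lemma is_chart_inj_on: "is_chart c \<Longrightarrow> inj_on (snd c) (fst c)"
  unfolding is_chart_def homeomorphism_def by (metis inj_onI)

lemma in_chart_apply: "is_chart c \<Longrightarrow> q \<in> fst c \<Longrightarrow> in_chart c f (snd c q) = f q"
  by (simp add: in_chart_def is_chart_inj_on)

lemma chart_point:
  assumes "u \<in> chart_image c"
  obtains q where "q \<in> fst c" "u = snd c q"
  using assms by (auto simp: chart_image_def)

lemma smooth_structure_chart: "smooth_structure A \<Longrightarrow> c \<in> A \<Longrightarrow> is_chart c"
  by (simp add: smooth_structure_def)

lemma smooth_structure_cover:
  assumes "smooth_structure A"
  obtains c where "c \<in> A" "p \<in> fst c"
  using assms unfolding smooth_structure_def by blast

lemma smooth_map_on_chart: "smooth_map_on A UNIV f \<Longrightarrow> c \<in> A \<Longrightarrow> smooth_on (chart_image c) (in_chart c f)"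
  by (simp add: smooth_map_on_def chart_image_def)

text \<open>Here the maximality of the atlas enters: a map with injective differential at
  \<open>p\<close> inverts smoothly near \<open>p\<close>, and compatibility with every chart of
  \<open>A\<close> makes its restriction a member of \<open>A\<close>.\<close>

lemma chart_of_coordinates:
  fixes y :: "'m::{t2_space, second_countable_topology} \<Rightarrow> real^'n::finite"
  assumes A: "smooth_structure A" and W: "open W" "p \<in> W" and y: "smooth_map_on A W y"
    and c: "c \<in> A" "p \<in> fst c" and inj: "inj (frechet_derivative (in_chart c y) (at (snd c p)))"
  obtains d where "d \<in> A" "p \<in> fst d" "fst d \<subseteq> W" "snd d = y"
proof -
  define k where "k = inv_into (fst c) (snd c)"
  have ch: "is_chart c" using smooth_structure_chart[OF A c(1)] .
  then have hom: "homeomorphism (fst c) (snd c ` fst c) (snd c) k" by (simp add: is_chart_def k_def)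
  define S where "S = snd c ` (fst c \<inter> W)"
  have S: "open S" "snd c p \<in> S" using open_chart_image_Int[OF ch W(1)] W(2) c(2) by (auto simp: S_def)
  have sm: "smooth_on S (in_chart c y)" using y c(1) by (simp add: smooth_map_on_def S_def)
  obtain U V g where U: "open U" "U \<subseteq> S" "snd c p \<in> U" and V: "open V"
    and fg: "homeomorphism U V (in_chart c y) g" and g: "smooth_on V g"
    using smooth_inverse_function[OF S(1) sm S(2) inj] by metis
  \<comment> \<open>The domain of the new chart: the part of the domain of \<open>c\<close> on which
    \<open>y\<close>, written in the coordinates of \<open>c\<close>, has been inverted.\<close>
  define Q where "Q = {q \<in> fst c. snd c q \<in> U}"
  have ksnd: "k (snd c q) = q" if "q \<in> fst c" for q using hom that by (simp add: homeomorphism_def)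
  have kU: "k ` U = Q"
  proof
    show "k ` U \<subseteq> Q" using U(2) ksnd by (auto simp: Q_def S_def)
    show "Q \<subseteq> k ` U"
    proof
      fix q assume "q \<in> Q"
      then show "q \<in> k ` U" using ksnd[of q] image_eqI[of q k "snd c q" U] by (simp add: Q_def)
    qed
  qed
  have sndQ: "snd c ` Q = U" using U(2) by (auto simp: Q_def S_def)
  have QW: "Q \<subseteq> W" using U(2) is_chart_inj_on[OF ch] by (auto simp: Q_def S_def inj_on_def)
  have "openin (top_of_set (fst c)) (k ` U)"
    using homeomorphism_imp_open_map[OF homeomorphism_symD[OF hom], of U] U(2) U(1)
    by (metis S_def Int_lower1 image_mono open_openin openin_open_eq open_subset subset_trans)
  then have Q: "open Q" using ch kU by (simp add: is_chart_def openin_open_eq)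
  have y_eq: "y q = in_chart c y (snd c q)" if "q \<in> fst c" for q
    using in_chart_apply[OF ch that, of y] by simp
  have homQ: "homeomorphism Q U (snd c) k"
    by (rule homeomorphism_of_subsets[OF hom]) (use kU sndQ U(2) in \<open>auto simp: Q_def S_def\<close>)
  have "homeomorphism Q V (in_chart c y \<circ> snd c) (k \<circ> g)" by (rule homeomorphism_compose[OF homQ fg])
  then have homy: "homeomorphism Q V y (k \<circ> g)"
    by (rule homeomorphism_cong) (use y_eq in \<open>auto simp: Q_def\<close>)
  then have injy: "inj_on y Q" and yQ: "y ` Q = V" and gV: "(k \<circ> g) ` V = Q"
    unfolding homeomorphism_def by (auto intro: inj_on_inverseI)
  have inv_y: "inv_into Q y v = k (g v)" if "v \<in> V" for v
  proof -
    have "k (g v) \<in> Q" "y (k (g v)) = v" using homy that by (auto simp: homeomorphism_def)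
    then show ?thesis using inv_into_f_f[OF injy, of "k (g v)"] by simp
  qed
  have homy': "homeomorphism Q V y (inv_into Q y)"
    by (rule homeomorphism_cong[OF homy]) (use inv_y in auto)
  have ch_d: "is_chart (Q, y)" using Q V homy' yQ by (simp add: is_chart_def)
  have "smoothly_compatible (Q, y) e" if e: "e \<in> A" for e
    unfolding smoothly_compatible_def fst_conv snd_conv
  proof
    have "smooth_on (snd e ` (fst e \<inter> W)) (in_chart e y)" using y e by (simp add: smooth_map_on_def)
    then show "smooth_on (snd e ` (Q \<inter> fst e)) (in_chart e y)"
      by (rule smooth_on_subset[rotated]) (use QW in auto)
    have op: "open (y ` (Q \<inter> fst e))"
      using open_chart_image_Int[OF ch_d, of "fst e"] smooth_structure_chart[OF A e] by (simp add: is_chart_def)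
    \<comment> \<open>The transition from the new chart to \<open>e\<close> passes through
      \<open>c\<close>: \<open>g\<close> takes \<open>y\<close>-coordinates back to those of
      \<open>c\<close>.\<close>
    have ce: "smooth_on (snd c ` (fst c \<inter> fst e)) (in_chart c (snd e))"
      using A c(1) e unfolding smooth_structure_def smoothly_compatible_def by blast
    have gy: "g (y q) = snd c q" if "q \<in> Q" for q
      using fg y_eq that by (auto simp: Q_def homeomorphism_def)
    have "smooth_on (y ` (Q \<inter> fst e)) (\<lambda>v. in_chart c (snd e) (g v))"
    proof (rule smooth_on_compose[OF op _ ce])
      show "g ` y ` (Q \<inter> fst e) \<subseteq> snd c ` (fst c \<inter> fst e)" using gy by (auto simp: Q_def)
      show "smooth_on (y ` (Q \<inter> fst e)) g" by (rule smooth_on_subset[OF _ g]) (use yQ in auto)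
    qed
    then show "smooth_on (y ` (Q \<inter> fst e)) (in_chart (Q, y) (snd e))"
      by (rule smooth_on_cong[OF op, rotated]) (use inv_y yQ in \<open>auto simp: in_chart_def k_def\<close>)
  qed
  then have "(Q, y) \<in> A" using A ch_d unfolding smooth_structure_def by blast
  moreover have "p \<in> Q" using U(3) c(2) by (simp add: Q_def)
  ultimately show ?thesis using that[of "(Q, y)"] QW by simp
qed

lemma frechet_derivative_axis_sum:
  assumes "(f has_derivative f') (at x)"
  shows "f' v = (\<Sum>i\<in>UNIV. v $ i *\<^sub>R coord_deriv i f (x :: real^'n::finite))"
proof -
  have "f' v = f' (\<Sum>i\<in>UNIV. v $ i *\<^sub>R axis i 1)"
    using basis_expansion[of v] by (simp add: scalar_mult_eq_scaleR)
  then show ?thesis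
    using has_derivative_linear[OF assms] frechet_derivative_eq[OF assms]
    by (simp add: linear_sum linear_scale coord_deriv_def)
qed

text \<open>The differential need only vanish in one chart around each point, which is what adapted
  charts deliver. A coordinate ball is convex, so the function is constant on its preimage, and
  connectedness makes local constancy global.\<close>

lemma connected_manifold_constant:
  fixes f :: "'m::{t2_space, second_countable_topology} \<Rightarrow> real"
  assumes A: "smooth_structure (A :: ('m, 'n::finite) chart set)" and conn: "connected (UNIV :: 'm set)" and f: "smooth_map_on A UNIV f"
    and zero: "\<And>p. \<exists>c\<in>A. p \<in> fst c \<and> (\<forall>u\<in>chart_image c. \<forall>i. coord_deriv i (in_chart c f) u = 0)"
  shows "f p = f q"
proof (rule connected_local_const[OF conn UNIV_I UNIV_I])
  show "\<forall>a\<in>UNIV. eventually (\<lambda>b. f a = f b) (at a within UNIV)"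
  proof
    fix a
    obtain c where c: "c \<in> A" "a \<in> fst c" "\<And>u i. u \<in> chart_image c \<Longrightarrow> coord_deriv i (in_chart c f) u = 0"
      using zero[of a] by blast
    have ch: "is_chart c" using smooth_structure_chart[OF A c(1)] .
    obtain r where r: "r > 0" "ball (snd c a) r \<subseteq> chart_image c"
      using open_chart_image[OF ch] c(2) open_contains_ball[of "chart_image c"] by (auto simp: chart_image_def)
    have d: "(in_chart c f has_derivative (\<lambda>h. 0)) (at u within ball (snd c a) r)" if "u \<in> ball (snd c a) r" for u
    proof -
      have u: "u \<in> chart_image c" using r(2) that by blast
      note d = smooth_on_has_derivative[OF smooth_map_on_chart[OF f c(1)] u]
      have "frechet_derivative (in_chart c f) (at u) = (\<lambda>h. 0)"
        using frechet_derivative_axis_sum[OF d] c(3)[OF u] by auto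
      then show ?thesis using d has_derivative_at_withinI by metis
    qed
    have eq: "in_chart c f u = in_chart c f (snd c a)" if "u \<in> ball (snd c a) r" for u
      by (rule has_derivative_zero_unique[OF _ d that]) (use r(1) in auto)
    have "continuous_on (fst c) (snd c)" using ch by (simp add: is_chart_def homeomorphism_def)
    then have "open (fst c \<inter> snd c -` ball (snd c a) r)"
      using ch by (intro continuous_open_preimage) (auto simp: is_chart_def)
    moreover have "f a = f b" if "b \<in> fst c \<inter> snd c -` ball (snd c a) r" for b
      using eq[of "snd c b"] that in_chart_apply[OF ch, of _ f] c(2) by auto
    ultimately show "eventually (\<lambda>b. f a = f b) (at a within UNIV)"
      unfolding eventually_at_topological using c(2) r(1)
      by (intro exI[of _ "fst c \<inter> snd c -` ball (snd c a) r"]) auto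
  qed
qed

section \<open>The Gauss formula\<close>

lemma matrix_inv_mult:
  assumes "invertible A"
  shows "A ** matrix_inv A = mat 1" "matrix_inv A ** A = mat 1"
proof -
  have "A ** matrix_inv A = mat 1 \<and> matrix_inv A ** A = mat 1"
    unfolding matrix_inv_def by (rule someI_ex) (use assms in \<open>simp add: invertible_def\<close>)
  then show "A ** matrix_inv A = mat 1" "matrix_inv A ** A = mat 1" by auto
qed

section \<open>Bilinear algebra of a metric and its first derivatives\<close>

lemma sum_rotate: "(\<Sum>i\<in>I. \<Sum>j\<in>J. \<Sum>k\<in>K. t i j k) = (\<Sum>j\<in>J. \<Sum>k\<in>K. \<Sum>i\<in>I. t i j k)"
  by (subst sum.swap, rule sum.cong[OF refl], rule sum.swap)

lemma metric_at_sum: "metric_at g p v w = (\<Sum>b\<in>UNIV. \<Sum>c\<in>UNIV. g p $ b $ c * v $ b * w $ c)"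
  by (simp add: metric_at_def inner_vec_def matrix_vector_mult_def sum_distrib_left mult_ac)

lemma metric_at_add_left: "metric_at g p (v + v') w = metric_at g p v w + metric_at g p v' w"
  by (simp add: metric_at_def inner_add_left)

lemma metric_at_diff_left: "metric_at g p (v - v') w = metric_at g p v w - metric_at g p v' w"
  by (simp add: metric_at_def inner_diff_left)

lemma metric_at_scaleR_left: "metric_at g p (r *\<^sub>R v) w = r * metric_at g p v w"
  by (simp add: metric_at_def)

lemma metric_at_sum_left: "metric_at g p (\<Sum>i\<in>I. v i) w = (\<Sum>i\<in>I. metric_at g p (v i) w)"
  by (simp add: metric_at_def inner_sum_left)

lemma metric_at_commute:
  assumes "transpose (g p) = g p"
  shows "metric_at g p v w = metric_at g p w v"
  unfolding metric_at_def using assms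
  by (metis dot_lmul_matrix inner_commute vector_transpose_matrix)

text \<open>This is (D_x g)(y, z): \<open>x\<close> is the direction of differentiation, and the
  derivative is evaluated on \<open>y\<close> and \<open>z\<close>.\<close>

definition metric_deriv :: "'k::finite metric \<Rightarrow> real^'k \<Rightarrow> real^'k \<Rightarrow> real^'k \<Rightarrow> real^'k \<Rightarrow> real" where
  "metric_deriv g p x y z =
     (\<Sum>a\<in>UNIV. \<Sum>b\<in>UNIV. \<Sum>c\<in>UNIV. coord_deriv a (\<lambda>q. g q $ b $ c) p * x $ a * y $ b * z $ c)"

text \<open>Christoffel symbols of the first kind. Later computations use them only in this lowered
  form, so the inverse of the induced metric is never worked out.\<close>

lemma christoffel_lower:
  assumes "invertible (g p)"
  shows "(\<Sum>k\<in>UNIV. g p $ m $ k * christoffel g k i j p) =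
    (coord_deriv i (\<lambda>y. g y $ j $ m) p + coord_deriv j (\<lambda>y. g y $ i $ m) p
      - coord_deriv m (\<lambda>y. g y $ i $ j) p) / 2"
proof -
  define E where "E = (\<lambda>l. coord_deriv i (\<lambda>y. g y $ j $ l) p + coord_deriv j (\<lambda>y. g y $ i $ l) p
      - coord_deriv l (\<lambda>y. g y $ i $ j) p)"
  have inv: "(\<Sum>k\<in>UNIV. g p $ m $ k * matrix_inv (g p) $ k $ l) = (if m = l then 1 else 0)" for l
    using matrix_inv_mult(1)[OF assms] by (simp add: matrix_matrix_mult_def mat_def vec_eq_iff)
  have "(\<Sum>k\<in>UNIV. g p $ m $ k * christoffel g k i j p) =
      (\<Sum>k\<in>UNIV. \<Sum>l\<in>UNIV. g p $ m $ k * matrix_inv (g p) $ k $ l * E l) / 2"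
    by (simp add: christoffel_def E_def sum_distrib_left sum_divide_distrib mult.assoc)
  also have "\<dots> = (\<Sum>l\<in>UNIV. (\<Sum>k\<in>UNIV. g p $ m $ k * matrix_inv (g p) $ k $ l) * E l) / 2"
    by (subst sum.swap) (simp add: sum_distrib_right)
  also have "\<dots> = E m / 2" by (simp add: inv if_distrib[of "\<lambda>z. z * _"] cong: if_cong)
  finally show ?thesis by (simp add: E_def)
qed

text \<open>Lowering the index turns the connection term into the Koszul combination of three first
  derivatives of the metric. The rest of the argument permutes summation indices to match the
  argument order of \<open>metric_deriv\<close>.\<close>

lemma metric_at_cov_along:
  assumes "invertible (g (f u))" "transpose (g (f u)) = g (f u)"
  shows "metric_at g (f u) (cov_along g f i Y u) w = metric_at g (f u) (coord_deriv i Y u) w +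
    (metric_deriv g (f u) (coord_deriv i f u) (Y u) w + metric_deriv g (f u) (Y u) (coord_deriv i f u) w
      - metric_deriv g (f u) w (coord_deriv i f u) (Y u)) / 2"
proof -
  define x where "x = coord_deriv i f u"
  define y where "y = Y u"
  define \<Gamma> where "\<Gamma> = (\<lambda>k a b. christoffel g k a b (f u))"
  define T where "T = (\<lambda>a b c. coord_deriv a (\<lambda>q. g q $ b $ c) (f u))"
  have "metric_at g (f u) (\<chi> k. \<Sum>a\<in>UNIV. \<Sum>b\<in>UNIV. \<Gamma> k a b * x $ a * y $ b) w =
    metric_at g (f u) w (\<chi> k. \<Sum>a\<in>UNIV. \<Sum>b\<in>UNIV. \<Gamma> k a b * x $ a * y $ b)"
    by (rule metric_at_commute) (rule assms(2))
  also have "\<dots> = (\<Sum>c\<in>UNIV. \<Sum>k\<in>UNIV. \<Sum>a\<in>UNIV. \<Sum>b\<in>UNIV. g (f u) $ c $ k * \<Gamma> k a b * (x $ a * y $ b * w $ c))"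
    by (simp add: metric_at_sum sum_distrib_left mult_ac)
  also have "\<dots> = (\<Sum>c\<in>UNIV. \<Sum>a\<in>UNIV. \<Sum>b\<in>UNIV. \<Sum>k\<in>UNIV. g (f u) $ c $ k * \<Gamma> k a b * (x $ a * y $ b * w $ c))"
    by (rule sum.cong[OF refl], rule sum_rotate)
  also have "\<dots> = (\<Sum>c\<in>UNIV. \<Sum>a\<in>UNIV. \<Sum>b\<in>UNIV. (T a b c + T b a c - T c a b) / 2 * (x $ a * y $ b * w $ c))"
    unfolding sum_distrib_right[symmetric] \<Gamma>_def T_def
    by (simp only: christoffel_lower[of g "f u", OF assms(1)])
  also have "\<dots> = ((\<Sum>c\<in>UNIV. \<Sum>a\<in>UNIV. \<Sum>b\<in>UNIV. T a b c * x $ a * y $ b * w $ c) +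
      (\<Sum>c\<in>UNIV. \<Sum>a\<in>UNIV. \<Sum>b\<in>UNIV. T b a c * x $ a * y $ b * w $ c) -
      (\<Sum>c\<in>UNIV. \<Sum>a\<in>UNIV. \<Sum>b\<in>UNIV. T c a b * x $ a * y $ b * w $ c)) / 2"
    by (simp add: sum.distrib[symmetric] sum_subtractf[symmetric] sum_divide_distrib algebra_simps add_divide_distrib diff_divide_distrib)
  also have "(\<Sum>c\<in>UNIV. \<Sum>a\<in>UNIV. \<Sum>b\<in>UNIV. T a b c * x $ a * y $ b * w $ c) =
      metric_deriv g (f u) x y w"
    unfolding metric_deriv_def T_def
    by (rule sum_rotate)
  also have "(\<Sum>c\<in>UNIV. \<Sum>a\<in>UNIV. \<Sum>b\<in>UNIV. T b a c * x $ a * y $ b * w $ c) =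
      (\<Sum>b\<in>UNIV. \<Sum>a\<in>UNIV. \<Sum>c\<in>UNIV. T b a c * x $ a * y $ b * w $ c)"
    by (subst sum.swap[of _ UNIV UNIV], subst (2) sum.swap, subst sum.swap, rule refl)
  also have "\<dots> = metric_deriv g (f u) y x w"
    unfolding metric_deriv_def T_def by (simp add: mult_ac)
  also have "(\<Sum>c\<in>UNIV. \<Sum>a\<in>UNIV. \<Sum>b\<in>UNIV. T c a b * x $ a * y $ b * w $ c) = metric_deriv g (f u) w x y"
    unfolding metric_deriv_def T_def by (simp add: mult_ac)
  finally show ?thesis
    by (simp add: cov_along_def metric_at_add_left x_def y_def \<Gamma>_def)
qed

text \<open>Dimension count: the image of \<open>L\<close> is 3-dimensional and lies in the
  3-dimensional orthogonal complement of \<phi>.\<close>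

lemma hyperplane_eq_range:
  fixes L :: "real^3 \<Rightarrow> real^4"
  assumes "linear L" "inj L" "\<phi> \<noteq> 0" "\<And>v. \<phi> \<bullet> L v = 0" "\<phi> \<bullet> T = 0"
  obtains v where "T = L v"
proof -
  have "range L = {x. \<phi> \<bullet> x = 0}"
  proof (rule subspace_dim_equal)
    show "subspace (range L)" using assms(1) by (simp add: linear_subspace_image)
    show "subspace {x. \<phi> \<bullet> x = 0}" by (rule subspace_hyperplane)
    show "range L \<subseteq> {x. \<phi> \<bullet> x = 0}" using assms(4) by auto
    have "dim (range L) = 3"
      using dim_image_eq[OF assms(1), of UNIV] assms(2) by simp
    then show "dim {x. \<phi> \<bullet> x = 0} \<le> dim (range L)"
      using dim_hyperplane[OF assms(3)] by simp
  qed
  then show ?thesis using that assms(5) by blast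
qed

text \<open>The geometry of a single chart, without the manifold. The sign in \<open>unit\<close> is
  +1 because the normals treated here lie in the plane of d_3 and d_4, where a Siklos metric is
  positive definite.\<close>

locale immersed_patch =
  fixes D :: "(real^4) set" and g :: "4 metric" and f N :: "real^3 \<Rightarrow> real^4" and U :: "(real^3) set"
  assumes open_D: "open D" and open_U: "open U" and f_in_D: "u \<in> U \<Longrightarrow> f u \<in> D"
    and metric_sym: "transpose (g x) = g x"
    and metric_smooth: "smooth_on D (\<lambda>x. g x $ b $ c)"
    and metric_invertible: "x \<in> D \<Longrightarrow> invertible (g x)"
    and smooth_f: "smooth_on U f"
    and inj_f: "u \<in> U \<Longrightarrow> inj (frechet_derivative f (at u))"
    and pullback_invertible: "u \<in> U \<Longrightarrow> invertible (pullback_metric g f u)"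
    and normal: "u \<in> U \<Longrightarrow> metric_at g (f u) (N u) (frechet_derivative f (at u) v) = 0"
    and unit: "u \<in> U \<Longrightarrow> metric_at g (f u) (N u) (N u) = 1"
begin

lemma commute: "metric_at g p v w = metric_at g p w v"
  by (rule metric_at_commute) (rule metric_sym)

lemma has_derivative_f: "u \<in> U \<Longrightarrow> (f has_derivative frechet_derivative f (at u)) (at u)"
  by (rule smooth_on_has_derivative[OF smooth_f])

lemma linear_f': "u \<in> U \<Longrightarrow> linear (frechet_derivative f (at u))"
  using has_derivative_f has_derivative_linear by blast

lemma f'_eq_sum: "u \<in> U \<Longrightarrow> frechet_derivative f (at u) v = (\<Sum>i\<in>UNIV. v $ i *\<^sub>R coord_deriv i f u)"
  by (rule frechet_derivative_axis_sum[OF has_derivative_f])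

lemma second_deriv_symmetric:
  assumes u: "u \<in> U"
  shows "coord_deriv i (coord_deriv j f) u = coord_deriv j (coord_deriv i f) u"
proof -
  have comp: "coord_deriv i (coord_deriv j f) u $ k = coord_deriv i (coord_deriv j (\<lambda>u. f u $ k)) u" for i j k
  proof -
    have 1: "coord_deriv j (\<lambda>u. f u $ k) v = coord_deriv j f v $ k" if "v \<in> U" for v
      using frechet_derivative_eq[OF bounded_linear.has_derivative[OF bounded_linear_vec_nth has_derivative_f[OF that]]]
      by (simp add: coord_deriv_def)
    note d = smooth_on_has_derivative[OF smooth_on_coord_deriv[OF smooth_f, of j] u]
    have "((\<lambda>v. coord_deriv j f v $ k) has_derivative (\<lambda>h. frechet_derivative (coord_deriv j f) (at u) h $ k)) (at u)"
      by (rule bounded_linear.has_derivative[OF bounded_linear_vec_nth d])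
    then have "(coord_deriv j (\<lambda>u. f u $ k) has_derivative (\<lambda>h. frechet_derivative (coord_deriv j f) (at u) h $ k)) (at u)"
      by (rule has_derivative_transform_within_open[OF _ open_U u]) (simp add: 1)
    then show ?thesis by (simp add: coord_deriv_def frechet_derivative_eq)
  qed
  show ?thesis
    by (rule vec_eq_iff[THEN iffD2])
      (simp add: comp coord_deriv_symmetric[OF open_U smooth_on_vec_nth[OF open_U smooth_f] u])
qed

lemma metric_component_deriv:
  assumes u: "u \<in> U"
  shows "((\<lambda>v. g (f v) $ b $ c) has_derivative
    (\<lambda>h. \<Sum>a\<in>UNIV. frechet_derivative f (at u) h $ a * coord_deriv a (\<lambda>q. g q $ b $ c) (f u))) (at u)"
proof -
  note d = smooth_on_has_derivative[OF metric_smooth f_in_D[OF u]]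
  show ?thesis
    using has_derivative_compose[OF has_derivative_f[OF u] d]
    by (simp add: frechet_derivative_axis_sum[OF d])
qed

text \<open>Product rule for the Gram matrix: one term differentiates the metric along
  \<open>f\<close>, the other two differentiate the tangent vectors.\<close>

lemma coord_deriv_pullback:
  assumes u: "u \<in> U"
  shows "coord_deriv i (\<lambda>u. pullback_metric g f u $ j $ m) u =
    metric_deriv g (f u) (coord_deriv i f u) (coord_deriv j f u) (coord_deriv m f u) +
    metric_at g (f u) (coord_deriv i (coord_deriv j f) u) (coord_deriv m f u) +
    metric_at g (f u) (coord_deriv j f u) (coord_deriv i (coord_deriv m f) u)"
proof -
  have d: "((\<lambda>v. coord_deriv j f v $ b) has_derivative (\<lambda>h. frechet_derivative (coord_deriv j f) (at u) h $ b)) (at u)" for j b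
    by (rule bounded_linear.has_derivative[OF bounded_linear_vec_nth
          smooth_on_has_derivative[OF smooth_on_coord_deriv[OF smooth_f] u]])
  have "(\<lambda>u. pullback_metric g f u $ j $ m) =
      (\<lambda>u. \<Sum>b\<in>UNIV. \<Sum>c\<in>UNIV. g (f u) $ b $ c * coord_deriv j f u $ b * coord_deriv m f u $ c)"
    by (simp add: pullback_metric_def metric_at_sum)
  moreover have "(\<dots> has_derivative (\<lambda>h. \<Sum>b\<in>UNIV. \<Sum>c\<in>UNIV.
      g (f u) $ b $ c * coord_deriv j f u $ b * frechet_derivative (coord_deriv m f) (at u) h $ c +
      (g (f u) $ b $ c * frechet_derivative (coord_deriv j f) (at u) h $ b +
        (\<Sum>a\<in>UNIV. frechet_derivative f (at u) h $ a * coord_deriv a (\<lambda>q. g q $ b $ c) (f u)) * coord_deriv j f u $ b)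
      * coord_deriv m f u $ c)) (at u)"
    by (intro has_derivative_sum has_derivative_mult d metric_component_deriv[OF u])
  ultimately have "coord_deriv i (\<lambda>u. pullback_metric g f u $ j $ m) u = (\<Sum>b\<in>UNIV. \<Sum>c\<in>UNIV.
      g (f u) $ b $ c * coord_deriv j f u $ b * coord_deriv i (coord_deriv m f) u $ c +
      (g (f u) $ b $ c * coord_deriv i (coord_deriv j f) u $ b +
        (\<Sum>a\<in>UNIV. coord_deriv i f u $ a * coord_deriv a (\<lambda>q. g q $ b $ c) (f u)) * coord_deriv j f u $ b)
      * coord_deriv m f u $ c)"
    by (simp only: coord_deriv_def[of i] frechet_derivative_eq)
  also have "\<dots> = (\<Sum>b\<in>UNIV. \<Sum>c\<in>UNIV. \<Sum>a\<in>UNIV.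
        coord_deriv a (\<lambda>q. g q $ b $ c) (f u) * coord_deriv i f u $ a * coord_deriv j f u $ b * coord_deriv m f u $ c) +
    metric_at g (f u) (coord_deriv i (coord_deriv j f) u) (coord_deriv m f u) +
    metric_at g (f u) (coord_deriv j f u) (coord_deriv i (coord_deriv m f) u)"
    by (simp add: metric_at_sum sum.distrib sum_distrib_left sum_distrib_right algebra_simps)
  also have "(\<Sum>b\<in>UNIV. \<Sum>c\<in>UNIV. \<Sum>a\<in>UNIV.
        coord_deriv a (\<lambda>q. g q $ b $ c) (f u) * coord_deriv i f u $ a * coord_deriv j f u $ b * coord_deriv m f u $ c) =
      metric_deriv g (f u) (coord_deriv i f u) (coord_deriv j f u) (coord_deriv m f u)"
    unfolding metric_deriv_def by (subst (2) sum.swap, subst sum.swap, subst sum.swap, rule sum.swap)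
  finally show ?thesis .
qed

text \<open>The tangential part of the ambient derivative is the Levi-Civita connection of the
  induced metric. In the combination of three derivatives of the Gram matrix, symmetry cancels all
  second derivatives of \<open>f\<close> except twice the one with indices \<open>i\<close>,
  \<open>j\<close>; the other terms are those of \<open>metric_at_cov_along\<close>.\<close>

lemma koszul:
  assumes u: "u \<in> U"
  shows "metric_at g (f u) (cov_along g f i (coord_deriv j f) u) (coord_deriv m f u) =
    (\<Sum>l\<in>UNIV. pullback_metric g f u $ m $ l * christoffel (pullback_metric g f) l i j u)"
  unfolding christoffel_lower[of "pullback_metric g f" u, OF pullback_invertible[OF u]]
    metric_at_cov_along[where g = g and f = f and u = u, OF metric_invertible[OF f_in_D[OF u]] metric_sym] coord_deriv_pullback[OF u]
  using second_deriv_symmetric[OF u, of j i] second_deriv_symmetric[OF u, of m i]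
    second_deriv_symmetric[OF u, of m j]
    commute[of "f u" "coord_deriv j f u" "coord_deriv i (coord_deriv m f) u"]
  by (simp add: field_simps)

lemma tangent:
  assumes u: "u \<in> U" and T: "metric_at g (f u) T (N u) = 0"
  obtains v where "T = frechet_derivative f (at u) v"
proof (rule hyperplane_eq_range[OF linear_f'[OF u] inj_f[OF u]])
  have gN: "(g (f u) *v N u) \<bullet> w = metric_at g (f u) w (N u)" for w
    by (simp add: metric_at_def inner_commute)
  show "g (f u) *v N u \<noteq> 0" using gN[of "N u"] unit[OF u] by auto
  show "(g (f u) *v N u) \<bullet> frechet_derivative f (at u) v = 0" for v
    using normal[OF u] by (simp add: gN commute[of _ _ "N u"])
  show "(g (f u) *v N u) \<bullet> T = 0" using T by (simp add: gN)
qed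

text \<open>This evaluates the definite description. Existence: without its normal component the
  derivative is tangent, and \<open>koszul\<close> with the nondegeneracy of the induced metric
  identifies its coefficients as the Christoffel symbols. Uniqueness: the normal is nonzero.\<close>

lemma second_ff_eq:
  assumes u: "u \<in> U"
  shows "second_ff g f N i j u = metric_at g (f u) (cov_along g f i (coord_deriv j f) u) (N u)"
proof -
  define Z where "Z = cov_along g f i (coord_deriv j f) u"
  define h where "h = metric_at g (f u) Z (N u)"
  define \<Gamma> where "\<Gamma> = (\<lambda>l. christoffel (pullback_metric g f) l i j u)"
  let ?G = "pullback_metric g f u"
  obtain v where v: "Z - h *\<^sub>R N u = frechet_derivative f (at u) v"
    by (rule tangent[OF u, of "Z - h *\<^sub>R N u"])
      (simp add: metric_at_diff_left metric_at_scaleR_left h_def unit[OF u])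
  have N0: "N u \<noteq> 0" using unit[OF u] by (auto simp: metric_at_def)
  have "?G *v v = ?G *v (\<chi> l. \<Gamma> l)"
  proof (rule vec_eq_iff[THEN iffD2], rule allI)
    fix m
    have Gsym: "?G $ m $ l = metric_at g (f u) (coord_deriv l f u) (coord_deriv m f u)" for l
      by (simp add: pullback_metric_def commute[of "f u" "coord_deriv l f u"])
    have "(?G *v v) $ m = metric_at g (f u) (frechet_derivative f (at u) v) (coord_deriv m f u)"
      by (simp add: matrix_vector_mult_def f'_eq_sum[OF u] metric_at_sum_left metric_at_scaleR_left Gsym mult.commute)
    also have "\<dots> = metric_at g (f u) Z (coord_deriv m f u)"
      using normal[OF u, of "axis m 1"]
      by (simp add: v[symmetric] metric_at_diff_left metric_at_scaleR_left coord_deriv_def)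
    also have "\<dots> = (?G *v (\<chi> l. \<Gamma> l)) $ m"
      by (simp add: koszul[OF u] Z_def matrix_vector_mult_def \<Gamma>_def)
    finally show "(?G *v v) $ m = (?G *v (\<chi> l. \<Gamma> l)) $ m" .
  qed
  then have "v = (\<chi> l. \<Gamma> l)"
    using matrix_inv_mult(2)[OF pullback_invertible[OF u]]
    by (metis matrix_vector_mul_assoc matrix_vector_mul_lid)
  then have Z: "Z = (\<Sum>l\<in>UNIV. \<Gamma> l *\<^sub>R coord_deriv l f u) + h *\<^sub>R N u"
    using v by (simp add: f'_eq_sum[OF u] algebra_simps)
  have "second_ff g f N i j u = h"
    unfolding second_ff_def Z_def[symmetric]
    by (rule the_equality) (use Z N0 in \<open>auto simp: \<Gamma>_def\<close>)
  then show ?thesis by (simp add: h_def Z_def)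
qed

end

section \<open>Siklos metrics\<close>

lemma metric_at_siklos:
  "metric_at (siklos_metric \<beta> H) x v w = \<beta>\<^sup>2 / (x $ 3)\<^sup>2 *
     (v $ 1 * w $ 2 + v $ 2 * w $ 1 + defining_fun H x * v $ 2 * w $ 2 + v $ 3 * w $ 3 + v $ 4 * w $ 4)"
  by (simp add: metric_at_def siklos_metric_def inner_vec_def matrix_vector_mult_def sum_4
      vector_4_component algebra_simps add_divide_distrib)

text \<open>The flat Lorentz metric in null coordinates. Splitting it off isolates the conformal
  factor and the single entry in which H occurs.\<close>

definition siklos_const :: "real^4^4" where
  "siklos_const = vector [vector [0, 1, 0, 0], vector [1, 0, 0, 0], vector [0, 0, 1, 0], vector [0, 0, 0, 1]]"

lemma siklos_metric_component:
  "siklos_metric \<beta> H x $ b $ c = \<beta>\<^sup>2 / (x $ 3)\<^sup>2 *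
     (siklos_const $ b $ c + (if b = 2 \<and> c = 2 then defining_fun H x else 0))"
  using exhaust_4[of b] exhaust_4[of c]
  by (auto simp: siklos_metric_def siklos_const_def vector_4_component)

lemma siklos_metric_symmetric: "transpose (siklos_metric \<beta> H x) = siklos_metric \<beta> H x"
  by (simp add: vec_eq_iff transpose_def forall_4 siklos_metric_def vector_4_component)

lemma siklos_metric_invertible:
  assumes "\<beta> \<noteq> 0" "x $ 3 \<noteq> 0"
  shows "invertible (siklos_metric \<beta> H x)"
  unfolding invertible_def
proof (intro exI conjI)
  let ?I = "((x $ 3)\<^sup>2 / \<beta>\<^sup>2) *\<^sub>R vector [vector [- defining_fun H x, 1, 0, 0], vector [1, 0, 0, 0],
    vector [0, 0, 1, 0], vector [0, 0, 0, 1]] :: real^4^4"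
  show "siklos_metric \<beta> H x ** ?I = mat 1" "?I ** siklos_metric \<beta> H x = mat 1"
    using assms by (simp_all add: vec_eq_iff forall_4 matrix_matrix_mult_def sum_4 mat_def siklos_metric_def
        vector_4_component)
qed

context
  fixes D :: "(real^4) set" and \<Lambda> \<beta> :: real and H :: "real \<Rightarrow> real \<Rightarrow> real \<Rightarrow> real"
  assumes siklos: "siklos_spacetime D \<Lambda> \<beta> H"
begin

lemma siklos_open: "open D"
  and siklos_x3: "x \<in> D \<Longrightarrow> x $ 3 \<noteq> 0"
  and siklos_smooth: "smooth_on D (defining_fun H)"
  using siklos by (auto simp: siklos_spacetime_def)

lemma siklos_beta: "\<beta> \<noteq> 0"
proof -
  have "\<beta>\<^sup>2 > 0" using siklos by (simp add: siklos_spacetime_def)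
  then show ?thesis by auto
qed

lemma smooth_on_coordinate: "smooth_on D (\<lambda>x. x $ i)"
  by (intro smooth_on_vec_nth smooth_on_ident siklos_open)

lemma siklos_metric_smooth: "smooth_on D (\<lambda>x. siklos_metric \<beta> H x $ b $ c)"
proof -
  have "smooth_on D (\<lambda>x. (x $ 3) * (x $ 3))"
    by (intro smooth_on_mult smooth_on_coordinate siklos_open)
  then have 1: "smooth_on D (\<lambda>x. \<beta>\<^sup>2 / ((x $ 3) * (x $ 3)))"
    by (intro smooth_on_divide smooth_on_const siklos_open) (use siklos_x3 in auto)
  have 2: "smooth_on D (\<lambda>x. if b = 2 \<and> c = 2 then defining_fun H x else 0)"
    by (cases "b = 2 \<and> c = 2") (auto simp: siklos_smooth smooth_on_const siklos_open)
  show ?thesis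
    unfolding siklos_metric_component power2_eq_square[of "_ $ 3"]
    by (intro smooth_on_mult smooth_on_add smooth_on_const siklos_open 1 2)
qed

lemma siklos_component_deriv:
  assumes x: "x \<in> D"
  shows "coord_deriv a (\<lambda>x. siklos_metric \<beta> H x $ b $ c) x =
    (if a = 3 then - 2 * \<beta>\<^sup>2 / (x $ 3) ^ 3 *
       (siklos_const $ b $ c + (if b = 2 \<and> c = 2 then defining_fun H x else 0)) else 0)
    + (if b = 2 \<and> c = 2 then \<beta>\<^sup>2 / (x $ 3)\<^sup>2 * dH H a x else 0)"
proof -
  have x3: "x $ 3 \<noteq> 0" using siklos_x3[OF x] .
  have H': "((\<lambda>x. if b = 2 \<and> c = 2 then defining_fun H x else 0) has_derivative
    (\<lambda>h. if b = 2 \<and> c = 2 then frechet_derivative (defining_fun H) (at x) h else 0)) (at x)"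
    by (cases "b = 2 \<and> c = 2") (auto intro: smooth_on_has_derivative[OF siklos_smooth x])
  have "((\<lambda>x. siklos_metric \<beta> H x $ b $ c) has_derivative (\<lambda>h.
      \<beta>\<^sup>2 / (x $ 3)\<^sup>2 * (if b = 2 \<and> c = 2 then frechet_derivative (defining_fun H) (at x) h else 0) +
      (- 2 * \<beta>\<^sup>2 / (x $ 3) ^ 3 * h $ 3) *
       (siklos_const $ b $ c + (if b = 2 \<and> c = 2 then defining_fun H x else 0)))) (at x)"
    unfolding siklos_metric_component
  proof (rule has_derivative_mult)
    show "((\<lambda>x. \<beta>\<^sup>2 / (x $ 3)\<^sup>2) has_derivative (\<lambda>h. - 2 * \<beta>\<^sup>2 / (x $ 3) ^ 3 * h $ 3)) (at x)"
      using x3 by (auto intro!: derivative_eq_intros bounded_linear.has_derivative[OF bounded_linear_vec_nth]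
          simp: field_simps power2_eq_square power3_eq_cube)
    show "((\<lambda>x. siklos_const $ b $ c + (if b = 2 \<and> c = 2 then defining_fun H x else 0)) has_derivative
      (\<lambda>h. if b = 2 \<and> c = 2 then frechet_derivative (defining_fun H) (at x) h else 0)) (at x)"
      using has_derivative_add[OF has_derivative_const H'] by simp
  qed
  then show ?thesis
    by (simp add: coord_deriv_def frechet_derivative_eq axis_def)
qed

text \<open>Only the conformal factor and H vary. The factor has logarithmic derivative -2 / x_3
  along the third axis and so reproduces the metric; H contributes only to dx_2^2.\<close>

lemma metric_deriv_siklos:
  assumes p: "p \<in> D"
  shows "metric_deriv (siklos_metric \<beta> H) p x y z =
    - 2 / p $ 3 * x $ 3 * metric_at (siklos_metric \<beta> H) p y z +
    \<beta>\<^sup>2 / (p $ 3)\<^sup>2 * (\<Sum>a\<in>UNIV. dH H a p * x $ a) * y $ 2 * z $ 2"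
proof -
  have [simp]: "p $ 3 \<noteq> 0" using siklos_x3[OF p] .
  define q where "q = \<beta>\<^sup>2 / (p $ 3)\<^sup>2"
  define r where "r = - 2 * \<beta>\<^sup>2 / (p $ 3) ^ 3"
  have r: "r = - 2 / p $ 3 * q" by (simp add: q_def r_def field_simps power2_eq_square power3_eq_cube)
  show ?thesis
    unfolding metric_deriv_def siklos_component_deriv[OF p] metric_at_siklos q_def[symmetric] r_def[symmetric]
    by (simp add: sum_4 siklos_const_def vector_4_component r algebra_simps)
qed

text \<open>Moving along the first axis leaves all three arguments of H unchanged.\<close>

lemma dH_1:
  assumes x: "x \<in> D"
  shows "dH H 1 x = 0"
proof -
  have "((\<lambda>t. x + t *\<^sub>R axis 1 1) has_derivative (\<lambda>t. t *\<^sub>R axis 1 1)) (at (0::real))"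
    by (auto intro!: derivative_eq_intros)
  moreover have "(defining_fun H has_derivative frechet_derivative (defining_fun H) (at x)) (at (x + 0 *\<^sub>R axis 1 1))"
    using smooth_on_has_derivative[OF siklos_smooth x] by simp
  ultimately have "((\<lambda>t. defining_fun H (x + t *\<^sub>R axis 1 1)) has_derivative
      (\<lambda>t. frechet_derivative (defining_fun H) (at x) (t *\<^sub>R axis 1 1))) (at 0)"
    by (rule has_derivative_compose)
  moreover have "(\<lambda>t. defining_fun H (x + t *\<^sub>R axis 1 1)) = (\<lambda>t. defining_fun H x)"
    by (simp add: defining_fun_def axis_def)
  ultimately have "(\<lambda>t. frechet_derivative (defining_fun H) (at x) (t *\<^sub>R axis 1 1)) = (\<lambda>t. 0)"
    using has_derivative_unique[OF _ has_derivative_const] by metis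
  from fun_cong[OF this, of 1] show ?thesis by (simp add: coord_deriv_def)
qed

lemma ddH_commute: "x \<in> D \<Longrightarrow> ddH H i j x = ddH H j i x"
  by (rule coord_deriv_symmetric[OF siklos_open siklos_smooth])

end

text \<open>Formulas for components such as \<open>second_ff\<close> are known only on the chart
  image; since that is open, they may still be differentiated there.\<close>

lemma coord_deriv_eq_on_open:
  assumes "open U" "u \<in> U" "\<And>v. v \<in> U \<Longrightarrow> k v = l v" "(l has_derivative l') (at u)"
  shows "coord_deriv i k u = l' (axis i 1)"
proof -
  have "(k has_derivative l') (at u)"
    by (rule has_derivative_transform_within_open[OF assms(4,1,2)]) (simp add: assms(3))
  then show ?thesis by (simp add: coord_deriv_def frechet_derivative_eq)
qed

lemma coord_deriv_const_on_open:
  assumes "open U" "u \<in> U" "\<And>v. v \<in> U \<Longrightarrow> k v = const"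
  shows "coord_deriv i k u = 0"
  using coord_deriv_eq_on_open[OF assms has_derivative_const] by simp

subsection \<open>Hypersurfaces orthogonal to a field in the plane of the last two coordinates\<close>

text \<open>\<open>c\<close> and \<open>s\<close> play cosine and sine of the normal angle; two
  smooth functions with \<open>unit_cs\<close> avoid choosing a branch of the angle.
  \<open>tangency\<close> is orthogonality to the normal with the factor \<beta> / x_3
  removed.\<close>

locale siklos_patch =
  fixes D :: "(real^4) set" and \<Lambda> \<beta> :: real and H :: "real \<Rightarrow> real \<Rightarrow> real \<Rightarrow> real"
    and f N :: "real^3 \<Rightarrow> real^4" and c s :: "real^3 \<Rightarrow> real" and U :: "(real^3) set"
  assumes siklos: "siklos_spacetime D \<Lambda> \<beta> H"
    and open_U: "open U" and f_in_D: "u \<in> U \<Longrightarrow> f u \<in> D"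
    and smooth_f: "smooth_on U f" and smooth_c: "smooth_on U c" and smooth_s: "smooth_on U s"
    and inj_f: "u \<in> U \<Longrightarrow> inj (frechet_derivative f (at u))"
    and pullback_invertible: "u \<in> U \<Longrightarrow> invertible (pullback_metric (siklos_metric \<beta> H) f u)"
    and N_eq: "u \<in> U \<Longrightarrow> N u = (f u $ 3 / \<beta> * c u) *\<^sub>R axis 3 1 + (f u $ 3 / \<beta> * s u) *\<^sub>R axis 4 1"
    and unit_cs: "u \<in> U \<Longrightarrow> c u * c u + s u * s u = 1"
    and tangency: "u \<in> U \<Longrightarrow> c u * frechet_derivative f (at u) v $ 3 + s u * frechet_derivative f (at u) v $ 4 = 0"
begin

abbreviation "g \<equiv> siklos_metric \<beta> H"
abbreviation "G \<equiv> pullback_metric g f"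
abbreviation "df i u \<equiv> coord_deriv i f u"
abbreviation "ddf i j u \<equiv> coord_deriv i (coord_deriv j f) u"
abbreviation "h i j u \<equiv> second_ff g f N i j u"
abbreviation "\<Gamma> l i j u \<equiv> christoffel G l i j u"

text \<open>The conformal factor times dH(N) / 2, that is, half of the part of the derivative of
  g_22 along the normal that is due to H.\<close>

definition w :: "real^3 \<Rightarrow> real" where
  "w u = \<beta> / f u $ 3 * (c u * dH H 3 (f u) + s u * dH H 4 (f u)) / 2"

lemmas beta = siklos_beta[OF siklos]

lemma f3: "u \<in> U \<Longrightarrow> f u $ 3 \<noteq> 0"
  using siklos_x3[OF siklos f_in_D] .

lemma N_components:
  assumes "u \<in> U"
  shows "N u $ 1 = 0" "N u $ 2 = 0" "N u $ 3 = f u $ 3 / \<beta> * c u" "N u $ 4 = f u $ 3 / \<beta> * s u"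
  using N_eq[OF assms] by (simp_all add: axis_def)

lemma metric_at_N:
  assumes "u \<in> U"
  shows "metric_at g (f u) v (N u) = \<beta> / f u $ 3 * (c u * v $ 3 + s u * v $ 4)"
  using f3[OF assms] beta
  by (simp add: metric_at_siklos N_components[OF assms] field_simps power2_eq_square)

lemma tangency_coord: "u \<in> U \<Longrightarrow> c u * df i u $ 3 + s u * df i u $ 4 = 0"
  using tangency by (simp add: coord_deriv_def)

sublocale immersed_patch D g f N U
proof unfold_locales
  show "metric_at g (f u) (N u) (frechet_derivative f (at u) v) = 0" if "u \<in> U" for u v
    using metric_at_N[OF that, of "frechet_derivative f (at u) v"] tangency[OF that, of v]
      metric_at_commute[of g "f u", OF siklos_metric_symmetric, of "N u" "frechet_derivative f (at u) v"]
    by simp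
  show "metric_at g (f u) (N u) (N u) = 1" if "u \<in> U" for u
  proof -
    have "metric_at g (f u) (N u) (N u) = \<beta> / f u $ 3 * (c u * (f u $ 3 / \<beta> * c u) + s u * (f u $ 3 / \<beta> * s u))"
      by (simp add: metric_at_N[OF that] N_components[OF that])
    also have "\<dots> = c u * c u + s u * s u" using f3[OF that] beta by (simp add: field_simps)
    finally show ?thesis using unit_cs[OF that] by simp
  qed
qed (auto simp: siklos_open[OF siklos] open_U f_in_D siklos_metric_symmetric siklos_metric_smooth[OF siklos]
    siklos_metric_invertible beta siklos_x3[OF siklos] smooth_f inj_f pullback_invertible)

lemma G_eq: "G u $ i $ j = metric_at g (f u) (df i u) (df j u)"
  by (simp add: pullback_metric_def)

lemma G_commute: "G u $ i $ j = G u $ j $ i"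
  by (simp add: G_eq commute[of _ "df i u"])

text \<open>Of the three metric derivatives in the contracted connection, the two evaluated on
  \<open>N\<close> vanish, because \<open>N\<close> is orthogonal to the tangent space and has no
  second component. The third differentiates the metric along \<open>N\<close>: the conformal factor
  yields a multiple of the induced metric, and H yields \<open>w\<close>.\<close>

lemma second_ff_siklos:
  assumes u: "u \<in> U"
  shows "h i j u = \<beta> / f u $ 3 * (c u * ddf i j u $ 3 + s u * ddf i j u $ 4)
    + c u / \<beta> * G u $ i $ j - w u * df i u $ 2 * df j u $ 2"
proof -
  have perp: "metric_at g (f u) (df i u) (N u) = 0" for i
    using metric_at_N[OF u] tangency_coord[OF u] by simp
  have S: "metric_deriv g (f u) (df i u) (df j u) (N u) = 0" for i j
    by (simp add: metric_deriv_siklos[OF siklos f_in_D[OF u]] perp N_components[OF u])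
  have "h i j u = metric_at g (f u) (ddf i j u) (N u) - metric_deriv g (f u) (N u) (df i u) (df j u) / 2"
    by (simp add: second_ff_eq[OF u] metric_at_cov_along[where g = g and f = f and u = u,
          OF metric_invertible[OF f_in_D[OF u]] metric_sym] S)
  also have "\<dots> = \<beta> / f u $ 3 * (c u * ddf i j u $ 3 + s u * ddf i j u $ 4)
    + c u / \<beta> * G u $ i $ j - w u * df i u $ 2 * df j u $ 2"
    using f3[OF u] beta
    by (simp add: metric_deriv_siklos[OF siklos f_in_D[OF u]] metric_at_N[OF u] sum_4 N_components[OF u]
        w_def G_eq field_simps power2_eq_square)
  finally show ?thesis .
qed

lemma coord_deriv_comp:
  assumes u: "u \<in> U" and \<phi>: "smooth_on D (\<phi> :: real^4 \<Rightarrow> real)"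
  shows "((\<lambda>v. \<phi> (f v)) has_derivative frechet_derivative (\<lambda>v. \<phi> (f v)) (at u)) (at u)"
    "coord_deriv i (\<lambda>v. \<phi> (f v)) u = (\<Sum>a\<in>UNIV. coord_deriv a \<phi> (f u) * df i u $ a)"
proof -
  note d = smooth_on_has_derivative[OF \<phi> f_in_D[OF u]]
  note e = has_derivative_compose[OF has_derivative_f[OF u] d]
  show "((\<lambda>v. \<phi> (f v)) has_derivative frechet_derivative (\<lambda>v. \<phi> (f v)) (at u)) (at u)"
    using e frechet_derivative_eq[OF e] by simp
  show "coord_deriv i (\<lambda>v. \<phi> (f v)) u = (\<Sum>a\<in>UNIV. coord_deriv a \<phi> (f u) * df i u $ a)"
    using frechet_derivative_eq[OF e] frechet_derivative_axis_sum[OF d, of "df i u"]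
    by (simp add: coord_deriv_def[of i] mult.commute)
qed

lemma Gamma_lower:
  assumes u: "u \<in> U"
  shows "(\<Sum>k\<in>UNIV. G u $ m $ k * \<Gamma> k i j u) =
    (coord_deriv i (\<lambda>y. G y $ j $ m) u + coord_deriv j (\<lambda>y. G y $ i $ m) u - coord_deriv m (\<lambda>y. G y $ i $ j) u) / 2"
  by (rule christoffel_lower[of G, OF pullback_invertible[OF u]])

text \<open>Differentiating \<open>tangency\<close> with constant coefficients removes the term with
  second derivatives of \<open>f\<close>.\<close>

lemma second_ff_constant_angle:
  assumes u: "u \<in> U" and c: "\<And>v. v \<in> U \<Longrightarrow> c v = c0" and s: "\<And>v. v \<in> U \<Longrightarrow> s v = s0"
  shows "h i j u = c0 / \<beta> * G u $ i $ j - w u * df i u $ 2 * df j u $ 2"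
proof -
  have d: "((\<lambda>v. df j v $ k) has_derivative (\<lambda>h. frechet_derivative (coord_deriv j f) (at u) h $ k)) (at u)" for k
    by (rule bounded_linear.has_derivative[OF bounded_linear_vec_nth
          smooth_on_has_derivative[OF smooth_on_coord_deriv[OF smooth_f] u]])
  have "((\<lambda>v. c0 * df j v $ 3 + s0 * df j v $ 4) has_derivative
      (\<lambda>h. c0 * frechet_derivative (coord_deriv j f) (at u) h $ 3 +
        s0 * frechet_derivative (coord_deriv j f) (at u) h $ 4)) (at u)"
    by (intro has_derivative_add has_derivative_mult_right d)
  then have "coord_deriv i (\<lambda>v. 0 :: real) u = c0 * ddf i j u $ 3 + s0 * ddf i j u $ 4"
    unfolding coord_deriv_def[of i "coord_deriv j f"]
    by (rule coord_deriv_eq_on_open[OF open_U u, rotated]) (use tangency_coord c s in auto)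
  then have "c0 * ddf i j u $ 3 + s0 * ddf i j u $ 4 = 0"
    by (simp add: coord_deriv_def)
  then show ?thesis using second_ff_siklos[OF u] by (simp add: c[OF u] s[OF u])
qed

text \<open>The induced metric has trace 3. The correction w dx_2^2 is trace-free because dx_2 is
  null: lowering the index of the tangent field d_1 gives a multiple of dx_2, and dx_2(d_1) =
  0.\<close>

lemma mean_curv_constant_angle:
  assumes u: "u \<in> U" and c: "\<And>v. v \<in> U \<Longrightarrow> c v = c0" and s: "\<And>v. v \<in> U \<Longrightarrow> s v = s0"
  shows "mean_curv g f N u = c0 / \<beta>"
proof -
  let ?I = "matrix_inv (G u)"
  note inv = matrix_inv_mult[OF pullback_invertible[OF u]]
  have "(\<Sum>j\<in>UNIV. ?I $ i $ j * G u $ i $ j) = 1" for i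
  proof -
    have "(\<Sum>j\<in>UNIV. ?I $ i $ j * G u $ i $ j) = (?I ** G u) $ i $ i"
      by (simp add: matrix_matrix_mult_def G_commute[of u i])
    then show ?thesis by (simp add: inv mat_def)
  qed
  then have tr: "(\<Sum>i\<in>UNIV. \<Sum>j\<in>UNIV. ?I $ i $ j * G u $ i $ j) = 3" by simp
  \<comment> \<open>The field d_1 has no third or fourth component, so it is tangent;
    \<open>v\<close> is its coordinate vector.\<close>
  obtain v where v: "axis 1 1 = frechet_derivative f (at u) v"
    by (rule tangent[OF u, of "axis 1 1"]) (simp add: metric_at_N[OF u] axis_def)
  define y where "y = (\<chi> j. df j u $ 2)"
  define q where "q = \<beta>\<^sup>2 / (f u $ 3)\<^sup>2"
  have q: "q \<noteq> 0" using f3[OF u] beta by (simp add: q_def)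
  \<comment> \<open>Lowering the index of d_1 gives \<open>q\<close> times the restriction of dx_2,
    whose components form \<open>y\<close>.\<close>
  have "G u *v v = q *\<^sub>R y"
  proof (rule vec_eq_iff[THEN iffD2], rule allI)
    fix j
    have "(G u *v v) $ j = metric_at g (f u) (frechet_derivative f (at u) v) (df j u)"
      by (simp add: matrix_vector_mult_def f'_eq_sum[OF u] metric_at_sum_left metric_at_scaleR_left
          G_commute[of u j] G_eq[symmetric] mult.commute)
    also have "\<dots> = q * df j u $ 2" by (simp add: v[symmetric] metric_at_siklos axis_def q_def)
    finally show "(G u *v v) $ j = (q *\<^sub>R y) $ j" by (simp add: y_def)
  qed
  then have "v = q *\<^sub>R (?I *v y)"
    using inv(2) by (metis matrix_vector_mul_assoc matrix_vector_mul_lid matrix_vector_mult_scaleR)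
  then have "q * (y \<bullet> (?I *v y)) = y \<bullet> v" by (simp add: inner_commute)
  also have "\<dots> = frechet_derivative f (at u) v $ 2"
    by (simp add: f'_eq_sum[OF u] y_def inner_vec_def mult.commute)
  also have "\<dots> = 0" by (simp add: v[symmetric] axis_def)
  finally have "y \<bullet> (?I *v y) = 0" using q by simp
  then have null: "(\<Sum>i\<in>UNIV. \<Sum>j\<in>UNIV. ?I $ i $ j * (df i u $ 2 * df j u $ 2)) = 0"
    by (simp add: inner_vec_def matrix_vector_mult_def y_def sum_distrib_left mult_ac)
  have hh: "h i j u = c0 / \<beta> * G u $ i $ j - w u * df i u $ 2 * df j u $ 2" for i j
    by (rule second_ff_constant_angle[OF u]) (use c s in auto)
  have "(\<Sum>i\<in>UNIV. \<Sum>j\<in>UNIV. ?I $ i $ j * h i j u) =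
      c0 / \<beta> * (\<Sum>i\<in>UNIV. \<Sum>j\<in>UNIV. ?I $ i $ j * G u $ i $ j)
      - w u * (\<Sum>i\<in>UNIV. \<Sum>j\<in>UNIV. ?I $ i $ j * (df i u $ 2 * df j u $ 2))"
    unfolding hh sum_distrib_left sum_subtractf[symmetric]
    by (simp add: algebra_simps)
  then show ?thesis unfolding tr null by (simp add: mean_curv_def)
qed

end

subsection \<open>Adapted coordinates\<close>

text \<open>u_1 and u_3 run along the first and second ambient axes and u_2 moves in the x_3-x_4
  plane; the numbering is that of the parametrizations to be reached.\<close>

locale adapted_patch = siklos_patch +
  assumes df1: "u \<in> U \<Longrightarrow> coord_deriv 1 f u = axis 1 1"
    and df3: "u \<in> U \<Longrightarrow> coord_deriv 3 f u = axis 2 1"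
    and df2: "u \<in> U \<Longrightarrow> coord_deriv 2 f u $ 1 = 0" "u \<in> U \<Longrightarrow> coord_deriv 2 f u $ 2 = 0"
begin

lemma df2_nonzero:
  assumes u: "u \<in> U"
  shows "df 2 u $ 3 \<noteq> 0 \<or> df 2 u $ 4 \<noteq> 0"
proof (rule ccontr)
  assume "\<not> ?thesis"
  then have "df 2 u = 0" using df2[OF u] by (simp only: vec_eq_iff forall_4 zero_index de_Morgan_disj not_not)
  moreover have "frechet_derivative f (at u) 0 = 0" using linear_0[OF linear_f'[OF u]] .
  ultimately have "axis 2 1 = (0 :: real^3)"
    using inj_f[OF u] unfolding coord_deriv_def by (metis injD)
  then show False by (metis axis_nth zero_index zero_neq_one)
qed

lemma ddf_zero:
  assumes u: "u \<in> U"
  shows "ddf i 1 u = 0" "ddf i 3 u = 0" "ddf 1 i u = 0" "ddf 3 i u = 0"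
proof -
  show 1: "ddf i 1 u = 0" by (rule coord_deriv_const_on_open[OF open_U u df1])
  show 3: "ddf i 3 u = 0" by (rule coord_deriv_const_on_open[OF open_U u df3])
  show "ddf 1 i u = 0" using 1 second_deriv_symmetric[OF u, of 1 i] by simp
  show "ddf 3 i u = 0" using 3 second_deriv_symmetric[OF u, of 3 i] by simp
qed

lemma G_adapted:
  assumes u: "u \<in> U"
  shows "G u $ 1 $ 1 = 0" "G u $ 1 $ 2 = 0" "G u $ 2 $ 1 = 0" "G u $ 2 $ 3 = 0" "G u $ 3 $ 2 = 0"
    "G u $ 3 $ 1 = g (f u) $ 2 $ 1" "G u $ 3 $ 3 = g (f u) $ 2 $ 2"
  using df1[OF u] df2[OF u] df3[OF u]
  by (simp_all add: G_eq metric_at_siklos axis_def siklos_metric_component siklos_const_def vector_4_component)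

lemma g21_nonzero: "u \<in> U \<Longrightarrow> g (f u) $ 2 $ 1 \<noteq> 0"
  using f3 beta by (simp add: siklos_metric_component siklos_const_def vector_4_component)

lemma G_deriv_zero:
  assumes u: "u \<in> U"
  shows "coord_deriv i (\<lambda>v. G v $ 1 $ 1) u = 0" "coord_deriv i (\<lambda>v. G v $ 1 $ 2) u = 0"
    "coord_deriv i (\<lambda>v. G v $ 2 $ 1) u = 0" "coord_deriv i (\<lambda>v. G v $ 2 $ 3) u = 0"
    "coord_deriv i (\<lambda>v. G v $ 3 $ 2) u = 0"
  by (rule coord_deriv_const_on_open[OF open_U u], simp add: G_adapted)+

lemma G13_eq: "(\<lambda>v. G v $ 1 $ 3) = (\<lambda>v. G v $ 3 $ 1)"
  by (rule ext) (rule G_commute)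

lemma G_deriv_31:
  assumes u: "u \<in> U"
  shows "((\<lambda>v. G v $ 3 $ 1) has_derivative frechet_derivative (\<lambda>v. G v $ 3 $ 1) (at u)) (at u)"
    "coord_deriv i (\<lambda>v. G v $ 3 $ 1) u = - 2 * \<beta>\<^sup>2 / (f u $ 3) ^ 3 * df i u $ 3"
proof -
  note c = coord_deriv_comp[OF u metric_smooth[of 2 1]]
  have d: "((\<lambda>v. G v $ 3 $ 1) has_derivative frechet_derivative (\<lambda>v. g (f v) $ 2 $ 1) (at u)) (at u)"
    by (rule has_derivative_transform_within_open[OF c(1) open_U u]) (simp add: G_adapted)
  then show "((\<lambda>v. G v $ 3 $ 1) has_derivative frechet_derivative (\<lambda>v. G v $ 3 $ 1) (at u)) (at u)"
    using frechet_derivative_eq by metis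
  have "coord_deriv i (\<lambda>v. G v $ 3 $ 1) u = coord_deriv i (\<lambda>v. g (f v) $ 2 $ 1) u"
    using frechet_derivative_eq[OF d] by (simp add: coord_deriv_def)
  then show "coord_deriv i (\<lambda>v. G v $ 3 $ 1) u = - 2 * \<beta>\<^sup>2 / (f u $ 3) ^ 3 * df i u $ 3"
    by (simp add: c(2) sum_4 siklos_component_deriv[OF siklos f_in_D[OF u]] siklos_const_def vector_4_component)
qed

lemma G_deriv_33:
  assumes u: "u \<in> U"
  shows "coord_deriv i (\<lambda>v. G v $ 3 $ 3) u =
    - 2 * \<beta>\<^sup>2 / (f u $ 3) ^ 3 * defining_fun H (f u) * df i u $ 3 +
    \<beta>\<^sup>2 / (f u $ 3)\<^sup>2 * (\<Sum>a\<in>UNIV. dH H a (f u) * df i u $ a)"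
proof -
  note c = coord_deriv_comp[OF u metric_smooth[of 2 2]]
  have d: "((\<lambda>v. G v $ 3 $ 3) has_derivative frechet_derivative (\<lambda>v. g (f v) $ 2 $ 2) (at u)) (at u)"
    by (rule has_derivative_transform_within_open[OF c(1) open_U u]) (simp add: G_adapted)
  have "coord_deriv i (\<lambda>v. G v $ 3 $ 3) u = coord_deriv i (\<lambda>v. g (f v) $ 2 $ 2) u"
    using frechet_derivative_eq[OF d] by (simp add: coord_deriv_def)
  then show ?thesis
    by (simp add: c(2) sum_4 siklos_component_deriv[OF siklos f_in_D[OF u]] siklos_const_def vector_4_component
        algebra_simps)
qed

text \<open>In the first row of \<open>G\<close> only the last entry is nonzero, so lowering to
  index 1 isolates the symbol with upper index 3. It is the one that multiplies \<open>w\<close> in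
  the covariant derivative of \<open>h\<close>.\<close>

lemma Gamma_3:
  assumes u: "u \<in> U"
  shows "g (f u) $ 2 $ 1 * \<Gamma> 3 i j u =
    (coord_deriv i (\<lambda>v. G v $ j $ 1) u + coord_deriv j (\<lambda>v. G v $ i $ 1) u - coord_deriv 1 (\<lambda>v. G v $ i $ j) u) / 2"
  using Gamma_lower[OF u, of 1 i j] G_adapted[OF u] G_commute[of u 1 3] by (simp add: sum_3)

lemma Gamma_3_i1:
  assumes u: "u \<in> U"
  shows "\<Gamma> 3 i 1 u = 0"
  using Gamma_3[OF u, of i 1] g21_nonzero[OF u] by (simp add: G_deriv_zero[OF u])

lemma h_adapted:
  assumes u: "u \<in> U"
  shows "h l 1 u = c u / \<beta> * G u $ 1 $ l" "h 3 1 u = c u / \<beta> * G u $ 3 $ 1" "h 3 2 u = c u / \<beta> * G u $ 3 $ 2"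
  using second_ff_siklos[OF u] ddf_zero[OF u] df1[OF u] df2[OF u] G_commute[of u 1 l]
  by (simp_all add: axis_def)

text \<open>Since \<open>\<partial>\<^sub>1\<close> is null and \<open>h(\<partial>\<^sub>1, \<cdot>) = (cos \<theta> / \<beta>) g(\<partial>\<^sub>1, \<cdot>)\<close>, compatibility of the connection with
  the metric leaves \<open>(\<nabla>\<^sub>i h)(\<partial>\<^sub>3, \<partial>\<^sub>1) = (\<partial>\<^sub>i cos \<theta> / \<beta>) g(\<partial>\<^sub>3, \<partial>\<^sub>1)\<close>.\<close>

lemma parallel_imp_angle_stationary:
  assumes u: "u \<in> U" and par: "cov_second_ff g f N i 3 1 u = 0"
  shows "coord_deriv i c u = 0"
proof -
  note dc = smooth_on_has_derivative[OF smooth_c u]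
  have "((\<lambda>v. c v / \<beta> * G v $ 3 $ 1) has_derivative (\<lambda>h. c u / \<beta> * frechet_derivative (\<lambda>v. G v $ 3 $ 1) (at u) h
      + frechet_derivative c (at u) h / \<beta> * G u $ 3 $ 1)) (at u)"
    by (rule has_derivative_mult[OF bounded_linear.has_derivative[OF bounded_linear_divide dc] G_deriv_31(1)[OF u]])
  from coord_deriv_eq_on_open[OF open_U u h_adapted(2) this]
  have "coord_deriv i (h 3 1) u = c u / \<beta> * coord_deriv i (\<lambda>v. G v $ 3 $ 1) u + coord_deriv i c u / \<beta> * G u $ 3 $ 1"
    by (simp add: coord_deriv_def)
  moreover have "(\<Sum>l\<in>UNIV. \<Gamma> l i 3 u * h l 1 u) = c u / \<beta> * (\<Sum>l\<in>UNIV. G u $ 1 $ l * \<Gamma> l i 3 u)"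
    by (simp add: h_adapted(1)[OF u] sum_distrib_left mult_ac)
  \<comment> \<open>The component \<open>h 3 3\<close> need not be a multiple of the metric;
    \<open>Gamma_3_i1\<close> removes it from this sum.\<close>
  moreover have "(\<Sum>l\<in>UNIV. \<Gamma> l i 1 u * h 3 l u) = c u / \<beta> * (\<Sum>l\<in>UNIV. G u $ 3 $ l * \<Gamma> l i 1 u)"
    by (simp add: sum_3 Gamma_3_i1[OF u] h_adapted(2,3)[OF u] algebra_simps)
  ultimately have "cov_second_ff g f N i 3 1 u = coord_deriv i c u / \<beta> * G u $ 3 $ 1"
    unfolding cov_second_ff_def Gamma_lower[OF u] G13_eq using beta by (simp add: field_simps)
  then show ?thesis using par g21_nonzero[OF u] beta by (simp add: G_adapted(6)[OF u])
qed

context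
  fixes c0 s0 :: real
  assumes c0: "\<And>v. v \<in> U \<Longrightarrow> c v = c0" and s0: "\<And>v. v \<in> U \<Longrightarrow> s v = s0"
begin

text \<open>In adapted coordinates dx_2 restricts to du_3, so the correction sits in a single
  entry.\<close>

lemma h_const:
  assumes u: "u \<in> U"
  shows "h i j u = c0 / \<beta> * G u $ i $ j - (if i = 3 \<and> j = 3 then w u else 0)"
proof -
  have "df i u $ 2 * df j u $ 2 = (if i = 3 \<and> j = 3 then 1 else 0)"
    using df1[OF u] df2[OF u] df3[OF u] exhaust_3[of i] exhaust_3[of j] by (auto simp: axis_def)
  moreover have "h i j u = c0 / \<beta> * G u $ i $ j - w u * df i u $ 2 * df j u $ 2"
    by (rule second_ff_constant_angle[OF u]) (use c0 s0 in auto)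
  ultimately show ?thesis by (simp add: mult.assoc)
qed

text \<open>The multiple of the induced metric is parallel, so the component reduces to
  \<open>\<Gamma> 3 3 2\<close> times \<open>w\<close>. That symbol measures the change of the
  conformal factor along u_2, and with s nonzero the u_2-lines do move in x_3.\<close>

lemma parallel_imp_w_zero:
  assumes u: "u \<in> U" and par: "cov_second_ff g f N 3 2 3 u = 0" and s: "s0 \<noteq> 0"
  shows "w u = 0"
proof -
  have 1: "coord_deriv 3 (h 2 3) u = 0"
    by (rule coord_deriv_const_on_open[OF open_U u]) (simp add: h_const G_adapted)
  have 2: "(\<Sum>l\<in>UNIV. \<Gamma> l 3 2 u * h l 3 u) =
      c0 / \<beta> * (\<Sum>l\<in>UNIV. G u $ 3 $ l * \<Gamma> l 3 2 u) - \<Gamma> 3 3 2 u * w u"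
    by (simp add: sum_3 h_const[OF u] G_commute[of u 1 3] G_commute[of u 2 3] algebra_simps)
  have 3: "(\<Sum>l\<in>UNIV. \<Gamma> l 3 3 u * h 2 l u) = c0 / \<beta> * (\<Sum>l\<in>UNIV. G u $ 2 $ l * \<Gamma> l 3 3 u)"
    by (simp add: sum_3 h_const[OF u] algebra_simps)
  have "cov_second_ff g f N 3 2 3 u = \<Gamma> 3 3 2 u * w u"
    unfolding cov_second_ff_def 1 2 3 Gamma_lower[OF u] using beta by (simp add: G_deriv_zero[OF u] field_simps)
  moreover have "\<Gamma> 3 3 2 u \<noteq> 0"
  proof -
    have "df 2 u $ 3 \<noteq> 0"
      using df2_nonzero[OF u] tangency_coord[OF u, of 2] s by (auto simp: s0[OF u])
    then show ?thesis
      using Gamma_3[OF u, of 3 2] G_deriv_31(2)[OF u, of 2] f3[OF u] beta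
      by (auto simp: G_deriv_zero[OF u])
  qed
  ultimately show ?thesis using par by simp
qed

text \<open>With s = 0 all derivatives of x_3 vanish, hence those of the conformal factor and the
  symbols \<open>\<Gamma> 3 i 3\<close>, and the component becomes the negative derivative of
  \<open>w\<close>. Up to a stationary nonzero factor \<open>w\<close> is H_3, which is therefore
  stationary along the second and fourth axes.\<close>

lemma parallel_imp_ddH_zero:
  assumes u: "u \<in> U" and par: "\<And>i. cov_second_ff g f N i 3 3 u = 0" and s: "s0 = 0"
  shows "ddH H 3 2 (f u) = 0" "ddH H 3 4 (f u) = 0"
proof -
  have c: "c0 \<noteq> 0" using unit_cs[OF u] s c0[OF u] s0[OF u] by auto
  have df_3: "df i v $ 3 = 0" if "v \<in> U" for i v
    using tangency_coord[OF that] c by (simp add: c0[OF that] s0[OF that] s)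
  have dG31: "coord_deriv i (\<lambda>v. G v $ 3 $ 1) u = 0" for i
    by (simp add: G_deriv_31(2)[OF u] df_3[OF u])
  have dG33: "coord_deriv 1 (\<lambda>v. G v $ 3 $ 3) u = 0"
    by (simp add: G_deriv_33[OF u] df_3[OF u] df1[OF u] sum_4 axis_def dH_1[OF siklos f_in_D[OF u]])
  have "\<Gamma> 3 i 3 u = 0" for i
    using Gamma_3[OF u, of i 3] g21_nonzero[OF u] exhaust_3[of i]
    by (auto simp: dG31 dG33 G_deriv_zero[OF u] G13_eq)
  note Gamma_3_i3 = this
  have dw: "coord_deriv i w u = \<beta> / f u $ 3 * c0 / 2 * coord_deriv i (\<lambda>v. dH H 3 (f v)) u"
    and dw': "(w has_derivative frechet_derivative w (at u)) (at u)" for i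
  proof -
    note d = coord_deriv_comp(1)[OF u smooth_on_coord_deriv[OF siklos_smooth[OF siklos], of 3]]
    have f3': "((\<lambda>v. f v $ 3) has_derivative (\<lambda>h. 0)) (at u)"
    proof -
      have "(\<lambda>h. frechet_derivative f (at u) h $ 3) = (\<lambda>h. 0)"
        by (simp add: f'_eq_sum[OF u] df_3[OF u])
      then show ?thesis using bounded_linear.has_derivative[OF bounded_linear_vec_nth has_derivative_f[OF u], of 3]
        by metis
    qed
    have "((\<lambda>v. \<beta> / f v $ 3 * (c0 * dH H 3 (f v)) / 2) has_derivative
      (\<lambda>h. \<beta> / f u $ 3 * c0 / 2 * frechet_derivative (\<lambda>v. dH H 3 (f v)) (at u) h)) (at u)"
      using f3[OF u] by (auto intro!: derivative_eq_intros f3' d simp: field_simps)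
    then have e: "(w has_derivative
      (\<lambda>h. \<beta> / f u $ 3 * c0 / 2 * frechet_derivative (\<lambda>v. dH H 3 (f v)) (at u) h)) (at u)"
      by (rule has_derivative_transform_within_open[OF _ open_U u]) (simp add: w_def c0 s0 s)
    then show "coord_deriv i w u = \<beta> / f u $ 3 * c0 / 2 * coord_deriv i (\<lambda>v. dH H 3 (f v)) u"
      by (simp add: coord_deriv_def frechet_derivative_eq)
    show "(w has_derivative frechet_derivative w (at u)) (at u)"
      using e frechet_derivative_eq[OF e] by simp
  qed
  have "coord_deriv i w u = 0" for i
  proof -
    note d33 = coord_deriv_comp(1)[OF u metric_smooth[of 2 2]]
    have "((\<lambda>v. c0 / \<beta> * g (f v) $ 2 $ 2 - w v) has_derivative
        (\<lambda>h. c0 / \<beta> * frechet_derivative (\<lambda>v. g (f v) $ 2 $ 2) (at u) h - frechet_derivative w (at u) h)) (at u)"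
      by (intro has_derivative_diff has_derivative_mult_right d33 dw')
    from coord_deriv_eq_on_open[OF open_U u _ this, of "h 3 3" i]
    have "coord_deriv i (h 3 3) u = c0 / \<beta> * coord_deriv i (\<lambda>v. g (f v) $ 2 $ 2) u - coord_deriv i w u"
      by (simp add: h_const G_adapted coord_deriv_def)
    also have "coord_deriv i (\<lambda>v. g (f v) $ 2 $ 2) u = coord_deriv i (\<lambda>v. G v $ 3 $ 3) u"
      using coord_deriv_eq_on_open[OF open_U u G_adapted(7) d33, of i] by (simp add: coord_deriv_def)
    finally have 1: "coord_deriv i (h 3 3) u = c0 / \<beta> * coord_deriv i (\<lambda>v. G v $ 3 $ 3) u - coord_deriv i w u" .
    have 2: "(\<Sum>l\<in>UNIV. \<Gamma> l i 3 u * h l 3 u) = c0 / \<beta> * (\<Sum>l\<in>UNIV. G u $ 3 $ l * \<Gamma> l i 3 u)"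
      "(\<Sum>l\<in>UNIV. \<Gamma> l i 3 u * h 3 l u) = c0 / \<beta> * (\<Sum>l\<in>UNIV. G u $ 3 $ l * \<Gamma> l i 3 u)"
      by (simp_all add: sum_3 h_const[OF u] Gamma_3_i3 G_commute[of u 1 3] G_commute[of u 2 3] algebra_simps)
    have "cov_second_ff g f N i 3 3 u = - coord_deriv i w u"
      unfolding cov_second_ff_def 1 2 Gamma_lower[OF u] using beta by (simp add: field_simps)
    then show ?thesis using par by simp
  qed
  then have "coord_deriv i (\<lambda>v. dH H 3 (f v)) u = 0" for i
    using dw[of i] f3[OF u] beta c by simp
  then have z: "(\<Sum>a\<in>UNIV. ddH H a 3 (f u) * df i u $ a) = 0" for i
    using coord_deriv_comp(2)[OF u smooth_on_coord_deriv[OF siklos_smooth[OF siklos], of 3], of i] by simp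
  show "ddH H 3 2 (f u) = 0"
    using z[of 3] by (simp add: df3[OF u] sum_4 axis_def ddH_commute[OF siklos f_in_D[OF u], of 3 2])
  show "ddH H 3 4 (f u) = 0"
    using z[of 2] df2_nonzero[OF u]
    by (simp add: df2[OF u] sum_4 df_3[OF u] ddH_commute[OF siklos f_in_D[OF u], of 3 4])
qed

end

end

section \<open>Global hypersurfaces\<close>

lemma smooth_map_on_continuous:
  assumes A: "smooth_structure A" and f: "smooth_map_on A UNIV f"
  shows "continuous_on UNIV f"
proof -
  have "continuous_on (fst c) f" if c: "c \<in> A" for c
  proof -
    have ch: "is_chart c" using smooth_structure_chart[OF A c] .
    have "continuous_on (fst c) (snd c)" using ch by (simp add: is_chart_def homeomorphism_def)
    moreover have "continuous_on (chart_image c) (in_chart c f)"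
      by (rule smooth_on_imp_continuous_on[OF smooth_map_on_chart[OF f c]])
    ultimately have "continuous_on (fst c) (in_chart c f \<circ> snd c)"
      unfolding chart_image_def by (rule continuous_on_compose)
    then show ?thesis
      by (rule continuous_on_eq) (simp add: in_chart_apply[OF ch])
  qed
  moreover have "open (fst c)" if "c \<in> A" for c
    using smooth_structure_chart[OF A that] by (simp add: is_chart_def)
  ultimately have "continuous_on (\<Union>c\<in>A. fst c) f" by (intro continuous_on_open_UN) auto
  then show ?thesis using A by (simp add: smooth_structure_def)
qed

lemma ambient_isometry_id: "open D \<Longrightarrow> ambient_isometry D g (\<lambda>x. x)"
  unfolding ambient_isometry_def
proof (intro conjI ballI)
  assume D: "open D"
  show "bij_betw (\<lambda>x. x) D D" by (simp add: bij_betw_def)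
  show "smooth_on D (\<lambda>x. x)" using D by (rule smooth_on_ident)
  then show "smooth_on D (inv_into D (\<lambda>x. x))"
    by (rule smooth_on_cong[OF D, rotated]) (metis f_inv_into_f image_ident)
  show "pullback_metric g (\<lambda>x. x) x = g x" for x
    by (simp add: pullback_metric_def coord_deriv_def frechet_derivative_eq[OF has_derivative_ident]
        vec_eq_iff metric_at_def inner_axis' matrix_vector_mult_basis column_def)
qed

lemma smooth_on_vector_3:
  assumes "open S" "smooth_on S f1" "smooth_on S f2" "smooth_on S f3"
  shows "smooth_on S (\<lambda>x. vector [f1 x, f2 x, f3 x] :: real^3)"
proof -
  have "(\<lambda>x. vector [f1 x, f2 x, f3 x] :: real^3) =
      (\<lambda>x. \<chi> i. (if i = 1 then f1 else if i = 2 then f2 else f3) x)"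
    by (simp add: fun_eq_iff vec_eq_iff forall_3)
  then show ?thesis using assms by (auto intro!: smooth_on_vec_lambda)
qed

locale siklos_hypersurface =
  fixes A :: "('m::{t2_space, second_countable_topology}, 3) chart set"
    and D :: "(real^4) set" and \<Lambda> \<beta> :: real and H :: "real \<Rightarrow> real \<Rightarrow> real \<Rightarrow> real"
    and F \<xi> :: "'m \<Rightarrow> real^4"
  assumes siklos: "siklos_spacetime D \<Lambda> \<beta> H"
    and manifold: "smooth_structure A" "connected (UNIV :: 'm set)"
    and hypersurface: "hypersurface A D (siklos_metric \<beta> H) F \<xi>"
    and parallel: "parallel_hypersurface A (siklos_metric \<beta> H) F \<xi>"
    and normal: "\<exists>\<theta>. \<xi> p = (F p $ 3 / \<beta> * cos \<theta>) *\<^sub>R axis 3 1 + (F p $ 3 / \<beta> * sin \<theta>) *\<^sub>R axis 4 1"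
begin

text \<open>The cosine recovered from the normal itself. As quotients of smooth functions,
  \<open>c\<close> and the sine \<open>s\<close> are global and smooth, whatever local angles
  describe the normal.\<close>

definition c :: "'m \<Rightarrow> real" where "c p = \<beta> * \<xi> p $ 3 / F p $ 3"
definition s :: "'m \<Rightarrow> real" where "s p = \<beta> * \<xi> p $ 4 / F p $ 3"

abbreviation "g \<equiv> siklos_metric \<beta> H"

lemmas beta = siklos_beta[OF siklos]

section \<open>Cosine and sine of the normal angle as global functions\<close>

lemma F_in_D: "F p \<in> D"
  using hypersurface by (auto simp: hypersurface_def)

lemma F3: "F p $ 3 \<noteq> 0"
  by (rule siklos_x3[OF siklos F_in_D])

lemma c_s_angle: "\<exists>\<theta>. c p = cos \<theta> \<and> s p = sin \<theta>"
proof -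
  obtain \<theta> where "\<xi> p = (F p $ 3 / \<beta> * cos \<theta>) *\<^sub>R axis 3 1 + (F p $ 3 / \<beta> * sin \<theta>) *\<^sub>R axis 4 1"
    using normal by blast
  then have "c p = cos \<theta>" "s p = sin \<theta>"
    using F3[of p] beta by (simp_all add: c_def s_def axis_def)
  then show ?thesis by blast
qed

lemma c_s_unit: "c p * c p + s p * s p = 1"
  using c_s_angle[of p] by (metis add.commute power2_eq_square sin_cos_squared_add)

lemma \<xi>_eq: "\<xi> p = (F p $ 3 / \<beta> * c p) *\<^sub>R axis 3 1 + (F p $ 3 / \<beta> * s p) *\<^sub>R axis 4 1"
proof -
  obtain \<theta> where "\<xi> p = (F p $ 3 / \<beta> * cos \<theta>) *\<^sub>R axis 3 1 + (F p $ 3 / \<beta> * sin \<theta>) *\<^sub>R axis 4 1"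
    using normal by blast
  moreover from this have "c p = cos \<theta>" "s p = sin \<theta>"
    using F3[of p] beta by (simp_all add: c_def s_def axis_def)
  ultimately show ?thesis by simp
qed

lemma smooth_F: "smooth_map_on A UNIV F" and smooth_\<xi>: "smooth_map_on A UNIV \<xi>"
  using hypersurface by (auto simp: hypersurface_def)

lemma in_chart_D: "in_chart d F u \<in> D"
  using F_in_D by (simp add: in_chart_def)

lemma smooth_component_quotient:
  assumes d: "d \<in> A"
  shows "smooth_on (chart_image d) (in_chart d (\<lambda>p. \<beta> * \<xi> p $ i / F p $ 3))"
proof -
  have op: "open (chart_image d)" using open_chart_image[OF smooth_structure_chart[OF manifold(1) d]] .
  have "smooth_on (chart_image d) (\<lambda>u. \<beta> * in_chart d \<xi> u $ i / in_chart d F u $ 3)"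
    by (intro smooth_on_divide smooth_on_mult smooth_on_const smooth_on_vec_nth op
        smooth_map_on_chart[OF smooth_F d] smooth_map_on_chart[OF smooth_\<xi> d])
      (simp add: siklos_x3[OF siklos in_chart_D])
  then show ?thesis by (simp add: in_chart_def comp_def)
qed

lemma smooth_c: "smooth_map_on A UNIV c" and smooth_s: "smooth_map_on A UNIV s"
  using smooth_component_quotient by (auto simp: smooth_map_on_def chart_image_def c_def[abs_def] s_def[abs_def])

lemma patch:
  assumes d: "d \<in> A"
  shows "siklos_patch D \<Lambda> \<beta> H (in_chart d F) (in_chart d \<xi>) (in_chart d c) (in_chart d s) (chart_image d)"
proof
  fix u v assume u: "u \<in> chart_image d"
  show N: "in_chart d \<xi> u = (in_chart d F u $ 3 / \<beta> * in_chart d c u) *\<^sub>R axis 3 1 +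
      (in_chart d F u $ 3 / \<beta> * in_chart d s u) *\<^sub>R axis 4 1"
    using \<xi>_eq by (simp add: in_chart_def)
  show "in_chart d c u * in_chart d c u + in_chart d s u * in_chart d s u = 1"
    using c_s_unit by (simp add: in_chart_def)
  have h: "inj (frechet_derivative (in_chart d F) (at u))"
    "invertible (pullback_metric g (in_chart d F) u)"
    "metric_at g (in_chart d F u) (in_chart d \<xi> u) (frechet_derivative (in_chart d F) (at u) v) = 0"
    using hypersurface d u by (auto simp: hypersurface_def)
  show "inj (frechet_derivative (in_chart d F) (at u))" "invertible (pullback_metric g (in_chart d F) u)"
    by fact+
  show "in_chart d c u * frechet_derivative (in_chart d F) (at u) v $ 3 +
      in_chart d s u * frechet_derivative (in_chart d F) (at u) v $ 4 = 0"
  proof -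
    have x3: "in_chart d F u $ 3 \<noteq> 0" by (rule siklos_x3[OF siklos in_chart_D])
    then have "metric_at g (in_chart d F u) (in_chart d \<xi> u) (frechet_derivative (in_chart d F) (at u) v) =
      \<beta> / in_chart d F u $ 3 * (in_chart d c u * frechet_derivative (in_chart d F) (at u) v $ 3 +
        in_chart d s u * frechet_derivative (in_chart d F) (at u) v $ 4)"
      using beta by (simp add: N metric_at_siklos axis_def field_simps power2_eq_square)
    then show ?thesis using h(3) x3 beta by simp
  qed
  show "in_chart d F u \<in> D" by (rule in_chart_D)
qed (use d siklos open_chart_image[OF smooth_structure_chart[OF manifold(1) d]]
    smooth_map_on_chart[OF smooth_F d] smooth_map_on_chart[OF smooth_c d] smooth_map_on_chart[OF smooth_s d] in auto)

text \<open>Three ambient functions restrict to coordinates near \<open>p\<close> as soon as their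
  differential is injective on the tangent space, which lies in the hyperplane c X_3 + s X_4 =
  0.\<close>

lemma chart_of_ambient_functions:
  fixes \<Psi> :: "real^4 \<Rightarrow> real^3"
  assumes E: "open E" "smooth_on E \<Psi>" and W: "open W" "p \<in> W" "F ` W \<subseteq> E"
    and inj: "\<And>X. c p * X $ 3 + s p * X $ 4 = 0 \<Longrightarrow> frechet_derivative \<Psi> (at (F p)) X = 0 \<Longrightarrow> X = 0"
  shows "\<exists>d\<in>A. p \<in> fst d \<and> fst d \<subseteq> W \<and> (\<forall>u\<in>chart_image d. \<Psi> (in_chart d F u) = u \<and> in_chart d F u \<in> E)"
proof -
  have y: "smooth_map_on A W (\<lambda>q. \<Psi> (F q))"
    unfolding smooth_map_on_def
  proof
    fix e assume e: "e \<in> A"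
    have ch: "is_chart e" by (rule smooth_structure_chart[OF manifold(1) e])
    have "smooth_on (snd e ` (fst e \<inter> W)) (\<lambda>u. \<Psi> (in_chart e F u))"
    proof (rule smooth_on_compose[OF open_chart_image_Int[OF ch W(1)] _ E(2)])
      show "in_chart e F ` snd e ` (fst e \<inter> W) \<subseteq> E"
        using W(3) by (auto simp: in_chart_apply[OF ch])
      show "smooth_on (snd e ` (fst e \<inter> W)) (in_chart e F)"
        by (rule smooth_on_subset[OF _ smooth_map_on_chart[OF smooth_F e]]) (auto simp: chart_image_def)
    qed
    then show "smooth_on (snd e ` (fst e \<inter> W)) (in_chart e (\<lambda>q. \<Psi> (F q)))"
      by (simp add: in_chart_def comp_def)
  qed
  obtain e where e: "e \<in> A" "p \<in> fst e" using smooth_structure_cover[OF manifold(1)] .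
  have ch: "is_chart e" by (rule smooth_structure_chart[OF manifold(1) e(1)])
  interpret e: siklos_patch D \<Lambda> \<beta> H "in_chart e F" "in_chart e \<xi>" "in_chart e c" "in_chart e s" "chart_image e"
    by (rule patch[OF e(1)])
  define u where "u = snd e p"
  have u: "u \<in> chart_image e" using e(2) by (simp add: u_def chart_image_def)
  have at: "in_chart e f u = f p" for f by (simp add: u_def in_chart_apply[OF ch e(2)])
  have d\<Psi>: "(\<Psi> has_derivative frechet_derivative \<Psi> (at (F p))) (at (in_chart e F u))"
    using smooth_on_has_derivative[OF E(2), of "F p"] W by (auto simp: at)
  have "((\<lambda>u. \<Psi> (in_chart e F u)) has_derivative
      (\<lambda>h. frechet_derivative \<Psi> (at (F p)) (frechet_derivative (in_chart e F) (at u) h))) (at u)"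
    by (rule has_derivative_compose[OF e.has_derivative_f[OF u] d\<Psi>])
  then have dy: "(in_chart e (\<lambda>q. \<Psi> (F q)) has_derivative
      (\<lambda>h. frechet_derivative \<Psi> (at (F p)) (frechet_derivative (in_chart e F) (at u) h))) (at u)"
    by (simp add: in_chart_def comp_def)
  have "inj (frechet_derivative (in_chart e (\<lambda>q. \<Psi> (F q))) (at (snd e p)))"
    unfolding u_def[symmetric] frechet_derivative_eq[OF dy] linear_injective_0[OF has_derivative_linear[OF dy]]
  proof (intro allI impI)
    fix v assume 0: "frechet_derivative \<Psi> (at (F p)) (frechet_derivative (in_chart e F) (at u) v) = 0"
    have "frechet_derivative (in_chart e F) (at u) v = 0"
      by (rule inj[OF _ 0]) (use e.tangency[OF u, of v] in \<open>simp add: at\<close>)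
    then show "v = 0"
      using e.inj_f[OF u] linear_injective_0[OF e.linear_f'[OF u]] by blast
  qed
  then obtain d where d: "d \<in> A" "p \<in> fst d" "fst d \<subseteq> W" "snd d = (\<lambda>q. \<Psi> (F q))"
    using chart_of_coordinates[OF manifold(1) W(1,2) y e] by metis
  have chd: "is_chart d" by (rule smooth_structure_chart[OF manifold(1) d(1)])
  have "\<Psi> (in_chart d F u) = u \<and> in_chart d F u \<in> E" if u: "u \<in> chart_image d" for u
  proof -
    obtain q where q: "q \<in> fst d" "u = snd d q" using u by (rule chart_point)
    have F: "in_chart d F u = F q" unfolding q(2) by (rule in_chart_apply[OF chd q(1)])
    have "u = \<Psi> (F q)" using q(2) by (simp add: d(4))
    then show ?thesis unfolding F using W(3) d(3) q(1) by auto
  qed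
  then show ?thesis using d(1-3) by blast
qed

text \<open>Chain rule for the identity by which \<Psi> recovers the k-th coordinate; it yields the
  components of the coordinate fields.\<close>

lemma chart_deriv:
  fixes \<Psi> :: "real^4 \<Rightarrow> real^3"
  assumes d: "d \<in> A" and u: "u \<in> chart_image d" and \<Psi>: "\<And>u. u \<in> chart_image d \<Longrightarrow> \<Psi> (in_chart d F u) $ k = u $ k"
    and l: "((\<lambda>x. \<Psi> x $ k) has_derivative l) (at (in_chart d F u))"
  shows "l (coord_deriv i (in_chart d F) u) = axis i 1 $ k"
proof -
  interpret d: siklos_patch D \<Lambda> \<beta> H "in_chart d F" "in_chart d \<xi>" "in_chart d c" "in_chart d s" "chart_image d"
    by (rule patch[OF d])
  have "((\<lambda>u. \<Psi> (in_chart d F u) $ k) has_derivative (\<lambda>h. l (frechet_derivative (in_chart d F) (at u) h))) (at u)"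
    by (rule has_derivative_compose[OF d.has_derivative_f[OF u] l])
  moreover have "((\<lambda>u. \<Psi> (in_chart d F u) $ k) has_derivative (\<lambda>h. h $ k)) (at u)"
    by (rule has_derivative_transform_within_open[OF bounded_linear_imp_has_derivative[OF bounded_linear_vec_nth] d.open_U u])
      (simp add: \<Psi>)
  ultimately have "(\<lambda>h. l (frechet_derivative (in_chart d F) (at u) h)) = (\<lambda>h. h $ k)"
    by (rule has_derivative_unique)
  then show ?thesis unfolding coord_deriv_def by (rule fun_cong)
qed

lemma frechet_derivative_component:
  fixes \<Psi> :: "real^4 \<Rightarrow> real^3"
  assumes "smooth_on E \<Psi>" "x \<in> E" "((\<lambda>x. \<Psi> x $ k) has_derivative l) (at x)"
  shows "frechet_derivative \<Psi> (at x) h $ k = l h"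
  using has_derivative_unique[OF bounded_linear.has_derivative[OF bounded_linear_vec_nth
        smooth_on_has_derivative[OF assms(1,2)]] assms(3)] by meson

lemma vec_nth_has_derivative: "((\<lambda>x. x $ k) has_derivative (\<lambda>h. h $ k)) (at (x :: real^'n))"
  by (rule bounded_linear_imp_has_derivative[OF bounded_linear_vec_nth])

text \<open>The tangent direction in the x_3-x_4 plane is (-s, c), so x_3 can serve as second
  coordinate where s is nonzero and x_4 where c is.\<close>

lemma adapted_chart:
  assumes j: "j = (3::4) \<and> s p \<noteq> 0 \<or> j = 4 \<and> c p \<noteq> 0"
  obtains d where "d \<in> A" "p \<in> fst d"
    "\<And>u. u \<in> chart_image d \<Longrightarrow> in_chart d F u $ 1 = u $ 1 \<and> in_chart d F u $ j = u $ 2 \<and> in_chart d F u $ 2 = u $ 3"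
    "adapted_patch D \<Lambda> \<beta> H (in_chart d F) (in_chart d \<xi>) (in_chart d c) (in_chart d s) (chart_image d)"
proof -
  let ?\<Psi> = "\<lambda>x::real^4. vector [x $ 1, x $ j, x $ 2] :: real^3"
  define k where "k = (if j = 3 then s else c)"
  have k: "continuous_on UNIV k"
    using smooth_map_on_continuous[OF manifold(1) smooth_c] smooth_map_on_continuous[OF manifold(1) smooth_s]
    by (simp add: k_def)
  \<comment> \<open>On all of the chart the chosen coefficient has to be nonzero: the fields of u_1
    and u_3 have zero j-th component, and \<open>tangency\<close> then removes their other component
    in the x_3-x_4 plane.\<close>
  define W where "W = {q. k q \<noteq> 0}"
  have W: "open W" unfolding W_def by (rule open_Collect_neq[OF k continuous_on_const])
  have pW: "p \<in> W" using j by (auto simp: W_def k_def)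
  have sm: "smooth_on UNIV ?\<Psi>"
    by (intro smooth_on_vector_3 smooth_on_vec_nth smooth_on_ident open_UNIV)
  have inj: "X = 0" if "c p * X $ 3 + s p * X $ 4 = 0" "frechet_derivative ?\<Psi> (at (F p)) X = 0" for X
  proof -
    have "frechet_derivative ?\<Psi> (at (F p)) X $ 1 = X $ 1" "frechet_derivative ?\<Psi> (at (F p)) X $ 2 = X $ j"
      "frechet_derivative ?\<Psi> (at (F p)) X $ 3 = X $ 2"
      by (rule frechet_derivative_component[OF sm UNIV_I], simp add: vec_nth_has_derivative)+
    then have "X $ 1 = 0" "X $ j = 0" "X $ 2 = 0" using that(2) by simp_all
    then show ?thesis using that(1) j by (auto simp: vec_eq_iff forall_4)
  qed
  have "\<exists>d\<in>A. p \<in> fst d \<and> fst d \<subseteq> W \<and> (\<forall>u\<in>chart_image d. ?\<Psi> (in_chart d F u) = u \<and> in_chart d F u \<in> UNIV)"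
    by (rule chart_of_ambient_functions[OF open_UNIV sm W pW subset_UNIV]) (rule inj)
  then obtain d where d: "d \<in> A" "p \<in> fst d" "fst d \<subseteq> W" "\<And>u. u \<in> chart_image d \<Longrightarrow> ?\<Psi> (in_chart d F u) = u"
    by blast
  have chd: "is_chart d" by (rule smooth_structure_chart[OF manifold(1) d(1)])
  interpret d: siklos_patch D \<Lambda> \<beta> H "in_chart d F" "in_chart d \<xi>" "in_chart d c" "in_chart d s" "chart_image d"
    by (rule patch[OF d(1)])
  have coords: "in_chart d F u $ 1 = u $ 1 \<and> in_chart d F u $ j = u $ 2 \<and> in_chart d F u $ 2 = u $ 3"
    if "u \<in> chart_image d" for u
    using d(4)[OF that] by (metis vector_3)
  have D: "coord_deriv i (in_chart d F) u $ 1 = axis i 1 $ 1" "coord_deriv i (in_chart d F) u $ j = axis i 1 $ 2"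
    "coord_deriv i (in_chart d F) u $ 2 = axis i 1 $ 3" if u: "u \<in> chart_image d" for i u
    by (rule chart_deriv[OF d(1) u, of ?\<Psi>]; simp add: d(4) vec_nth_has_derivative; use coords in blast)+
  have nz: "in_chart d k u \<noteq> 0" if "u \<in> chart_image d" for u
    using that d(3) by (auto elim!: chart_point simp: in_chart_apply[OF chd] W_def)
  have T: "coord_deriv i (in_chart d F) u $ 3 = 0 \<and> coord_deriv i (in_chart d F) u $ 4 = 0"
    if "u \<in> chart_image d" "i \<noteq> 2" for u i
    using d.tangency_coord[OF that(1), of i] D(2)[OF that(1), of i] that(2) nz[OF that(1)] j
    by (auto simp: axis_def k_def)
  have "adapted_patch D \<Lambda> \<beta> H (in_chart d F) (in_chart d \<xi>) (in_chart d c) (in_chart d s) (chart_image d)"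
    by unfold_locales (use D T in \<open>auto simp: vec_eq_iff forall_4 axis_def\<close>)
  with d(1,2) coords show ?thesis using that by blast
qed

lemma adapted_chart_exists:
  obtains d where "d \<in> A" "p \<in> fst d"
    "adapted_patch D \<Lambda> \<beta> H (in_chart d F) (in_chart d \<xi>) (in_chart d c) (in_chart d s) (chart_image d)"
proof -
  have "s p \<noteq> 0 \<or> c p \<noteq> 0" using c_s_unit[of p] by auto
  then show ?thesis using adapted_chart[of _ p] that by metis
qed

section \<open>Constancy of the angle and its consequences\<close>

lemma cov_zero: "d \<in> A \<Longrightarrow> u \<in> chart_image d \<Longrightarrow> cov_second_ff g (in_chart d F) (in_chart d \<xi>) i j k u = 0"
  using parallel by (simp add: parallel_hypersurface_def)

lemma c_constant: "c p = c q"
proof (rule connected_manifold_constant[OF manifold smooth_c])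
  fix p
  obtain d where d: "d \<in> A" "p \<in> fst d" and "adapted_patch D \<Lambda> \<beta> H (in_chart d F) (in_chart d \<xi>) (in_chart d c) (in_chart d s) (chart_image d)"
    by (rule adapted_chart_exists)
  from this(3) interpret d: adapted_patch D \<Lambda> \<beta> H "in_chart d F" "in_chart d \<xi>" "in_chart d c" "in_chart d s" "chart_image d" .
  show "\<exists>d\<in>A. p \<in> fst d \<and> (\<forall>u\<in>chart_image d. \<forall>i. coord_deriv i (in_chart d c) u = 0)"
    using d d.parallel_imp_angle_stationary cov_zero[OF d(1)] by blast
qed

text \<open>With c constant, s^2 = 1 - c^2 leaves at most two values, and a continuous function of
  finite range on a connected space is constant.\<close>

lemma s_constant: "s p = s q"
proof -
  have "finite (range s)"
  proof (rule finite_subset)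
    show "range s \<subseteq> {s p, - s p}"
    proof
      fix y assume "y \<in> range s"
      then obtain r where r: "y = s r" by blast
      have "s r * s r = s p * s p" using c_s_unit[of r] c_s_unit[of p] c_constant[of r p] by simp
      then show "y \<in> {s p, - s p}" using r by (simp add: square_eq_iff)
    qed
  qed simp
  then have "s constant_on UNIV"
    by (rule continuous_finite_range_constant[OF manifold(2) smooth_map_on_continuous[OF manifold(1) smooth_s]])
  then show ?thesis by (auto simp: constant_on_def)
qed

lemma in_chart_c_s: "in_chart d c u = c p" "in_chart d s u = s p"
  using c_constant s_constant by (simp_all add: in_chart_def)

lemma constant_mean_curvature: "constant_mean_curvature A g F \<xi>"
  unfolding constant_mean_curvature_def
proof (intro exI ballI)
  fix d u assume d: "d \<in> A" and u: "u \<in> chart_image d"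
  interpret d: siklos_patch D \<Lambda> \<beta> H "in_chart d F" "in_chart d \<xi>" "in_chart d c" "in_chart d s" "chart_image d"
    by (rule patch[OF d])
  \<comment> \<open>\<open>undefined\<close> is merely a base point; \<open>c\<close> takes the same
    value everywhere.\<close>
  show "mean_curv g (in_chart d F) (in_chart d \<xi>) u = c undefined / \<beta>"
    by (rule d.mean_curv_constant_angle[OF u in_chart_c_s])
qed

lemma adapted_facts:
  shows "s p \<noteq> 0 \<Longrightarrow> c p * dH H 3 (F p) + s p * dH H 4 (F p) = 0"
    and "s p = 0 \<Longrightarrow> ddH H 3 2 (F p) = 0 \<and> ddH H 3 4 (F p) = 0"
proof -
  obtain d where d: "d \<in> A" "p \<in> fst d" and "adapted_patch D \<Lambda> \<beta> H (in_chart d F) (in_chart d \<xi>) (in_chart d c) (in_chart d s) (chart_image d)"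
    by (rule adapted_chart_exists)
  from this(3) interpret d: adapted_patch D \<Lambda> \<beta> H "in_chart d F" "in_chart d \<xi>" "in_chart d c" "in_chart d s" "chart_image d" .
  have u: "snd d p \<in> chart_image d" using d(2) by (simp add: chart_image_def)
  have at: "in_chart d f (snd d p) = f p" for f :: "'m \<Rightarrow> 'b"
    by (rule in_chart_apply[OF smooth_structure_chart[OF manifold(1) d(1)] d(2)])
  show "c p * dH H 3 (F p) + s p * dH H 4 (F p) = 0" if "s p \<noteq> 0"
    using d.parallel_imp_w_zero[OF in_chart_c_s u cov_zero[OF d(1) u] that] F3[of p] beta
    by (simp add: d.w_def at)
  show "ddH H 3 2 (F p) = 0 \<and> ddH H 3 4 (F p) = 0" if "s p = 0"
    using d.parallel_imp_ddH_zero[OF in_chart_c_s u cov_zero[OF d(1) u] that] by (simp add: at)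
qed

text \<open>If c = 0 then s is nonzero, which forces w = 0, and both terms of the second fundamental
  form are gone.\<close>

lemma totally_geodesic_if_c_zero:
  assumes "c p = 0"
  shows "totally_geodesic A g F \<xi>"
  unfolding totally_geodesic_def
proof (intro ballI allI)
  fix d u i j assume d: "d \<in> A" and u: "u \<in> chart_image d"
  interpret d: siklos_patch D \<Lambda> \<beta> H "in_chart d F" "in_chart d \<xi>" "in_chart d c" "in_chart d s" "chart_image d"
    by (rule patch[OF d])
  obtain q where q: "q \<in> fst d" "u = snd d q" using u by (rule chart_point)
  have F: "in_chart d F u = F q"
    unfolding q(2) by (rule in_chart_apply[OF smooth_structure_chart[OF manifold(1) d] q(1)])
  have "c q = 0" using assms c_constant[of q p] by simp
  moreover from this have "s q \<noteq> 0" using c_s_unit[of q] by auto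
  ultimately have "d.w u = 0"
    using adapted_facts(1)[of q] by (simp add: d.w_def F in_chart_c_s[of d u q])
  moreover have "second_ff g (in_chart d F) (in_chart d \<xi>) i j u = c q / \<beta> * d.G u $ i $ j
      - d.w u * d.df i u $ 2 * d.df j u $ 2"
    by (rule d.second_ff_constant_angle[OF u in_chart_c_s])
  ultimately show "second_ff g (in_chart d F) (in_chart d \<xi>) i j u = 0"
    using \<open>c q = 0\<close> by simp
qed

text \<open>With c and s constant, the differential of this function is the left-hand side of
  \<open>tangency\<close>.\<close>

lemma orthogonal_coordinate_constant: "c p * F p $ 3 + s p * F p $ 4 = c q * F q $ 3 + s q * F q $ 4"
proof -
  define k where "k = (\<lambda>p. c p * F p $ 3 + s p * F p $ 4)"
  have k: "in_chart d k = (\<lambda>u. in_chart d c u * in_chart d F u $ 3 + in_chart d s u * in_chart d F u $ 4)" for d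
    by (simp add: in_chart_def k_def comp_def)
  have "k p = k q"
  proof (rule connected_manifold_constant[OF manifold])
    show "smooth_map_on A UNIV k"
      unfolding smooth_map_on_def
    proof
      fix d assume d: "d \<in> A"
      have op: "open (chart_image d)" using open_chart_image[OF smooth_structure_chart[OF manifold(1) d]] .
      have "smooth_on (chart_image d) (in_chart d k)"
        unfolding k by (intro smooth_on_add smooth_on_mult smooth_on_vec_nth op smooth_map_on_chart[OF _ d]
            smooth_F smooth_c smooth_s)
      then show "smooth_on (snd d ` (fst d \<inter> UNIV)) (in_chart d k)" by (simp add: chart_image_def)
    qed
    fix r
    obtain d where d: "d \<in> A" "r \<in> fst d" using smooth_structure_cover[OF manifold(1)] .
    interpret d: siklos_patch D \<Lambda> \<beta> H "in_chart d F" "in_chart d \<xi>" "in_chart d c" "in_chart d s" "chart_image d"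
      by (rule patch[OF d(1)])
    have "coord_deriv i (in_chart d k) u = 0" if u: "u \<in> chart_image d" for u i
    proof -
      note dF = bounded_linear.has_derivative[OF bounded_linear_vec_nth d.has_derivative_f[OF u]]
      have "((\<lambda>u. c r * in_chart d F u $ 3 + s r * in_chart d F u $ 4) has_derivative
          (\<lambda>h. c r * frechet_derivative (in_chart d F) (at u) h $ 3 + s r * frechet_derivative (in_chart d F) (at u) h $ 4)) (at u)"
        by (intro has_derivative_add has_derivative_mult_right dF)
      moreover have "in_chart d k = (\<lambda>u. c r * in_chart d F u $ 3 + s r * in_chart d F u $ 4)"
        unfolding k by (simp add: in_chart_c_s[of d _ r])
      ultimately show ?thesis
        using d.tangency[OF u, of "axis i 1"] by (simp add: coord_deriv_def frechet_derivative_eq in_chart_c_s[of d u r])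
    qed
    then show "\<exists>d\<in>A. r \<in> fst d \<and> (\<forall>u\<in>chart_image d. \<forall>i. coord_deriv i (in_chart d k) u = 0)"
      using d by blast
  qed
  then show ?thesis by (simp add: k_def)
qed

text \<open>x_3 never vanishes on connected M and so keeps one sign; \<rho> is that sign and becomes
  the constant of the oblique parametrization.\<close>

lemma F3_sign:
  obtains \<rho> :: real where "\<rho> \<noteq> 0" "\<rho> * \<rho> = 1" "\<And>p. \<rho> * F p $ 3 > 0"
proof -
  have "connected (range (\<lambda>p. F p $ 3))"
    by (intro connected_continuous_image manifold continuous_on_component smooth_map_on_continuous[OF manifold(1) smooth_F])
  then have int: "is_interval (range (\<lambda>p. F p $ 3))" by (simp add: is_interval_connected_1)
  have "F p $ 3 > 0" if "F q $ 3 > 0" for p q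
  proof (rule ccontr)
    assume "\<not> F p $ 3 > 0"
    then have "0 \<in> range (\<lambda>p. F p $ 3)"
      using that by (intro mem_is_interval_1_I[OF int, of "F p $ 3" "F q $ 3" 0]) auto
    then obtain r where "0 = F r $ 3" by blast
    then show False using F3[of r] by simp
  qed
  note pos = this
  show ?thesis
  proof (cases "\<exists>q. F q $ 3 > 0")
    case True
    then show ?thesis using pos by (intro that[of 1]) auto
  next
    case False
    then have "F p $ 3 < 0" for p using F3[of p] by (metis linorder_neqE_linordered_idom)
    then show ?thesis by (intro that[of "- 1"]) auto
  qed
qed

text \<open>Where s is nonzero x_3 is a coordinate, hence so is ln |x_3| = ln (\<rho> x_3); using it
  as u_2 produces the exponential.\<close>

lemma exponential_chart:
  assumes s: "s p \<noteq> 0" and \<rho>: "\<rho> * \<rho> = 1" "\<And>q. \<rho> * F q $ 3 > 0"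
  obtains d where "d \<in> A" "p \<in> fst d"
    "\<And>u. u \<in> chart_image d \<Longrightarrow> in_chart d F u $ 1 = u $ 1 \<and> in_chart d F u $ 3 = \<rho> * exp (u $ 2) \<and> in_chart d F u $ 2 = u $ 3"
proof -
  let ?\<Psi> = "\<lambda>x::real^4. vector [x $ 1, ln (\<rho> * x $ 3), x $ 2] :: real^3"
  define E where "E = {x::real^4. \<rho> * x $ 3 > 0}"
  have E: "open E" unfolding E_def by (intro open_Collect_less continuous_intros)
  have sm: "smooth_on E ?\<Psi>"
    by (intro smooth_on_vector_3 smooth_on_ln smooth_on_mult smooth_on_const smooth_on_vec_nth smooth_on_ident E)
      (simp add: E_def)
  have FE: "F q \<in> E" for q using \<rho>(2) by (simp add: E_def)
  have inj: "X = 0" if "c p * X $ 3 + s p * X $ 4 = 0" "frechet_derivative ?\<Psi> (at (F p)) X = 0" for X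
  proof -
    have ln': "((\<lambda>x. ln (\<rho> * x $ 3)) has_derivative (\<lambda>h. (\<rho> * h $ 3) * inverse (\<rho> * F p $ 3))) (at (F p))"
      by (rule has_derivative_ln[OF \<rho>(2) has_derivative_mult_right[OF vec_nth_has_derivative]])
    have "frechet_derivative ?\<Psi> (at (F p)) X $ 1 = X $ 1" "frechet_derivative ?\<Psi> (at (F p)) X $ 3 = X $ 2"
      by (rule frechet_derivative_component[OF sm FE], simp add: vec_nth_has_derivative)+
    moreover have "frechet_derivative ?\<Psi> (at (F p)) X $ 2 = (\<rho> * X $ 3) * inverse (\<rho> * F p $ 3)"
      by (rule frechet_derivative_component[OF sm FE]) (simp only: vector_3, rule ln')
    ultimately have "X $ 1 = 0" "X $ 3 = 0" "X $ 2 = 0" using that(2) \<rho>(1) F3[of p] by auto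
    then show ?thesis using that(1) s by (auto simp: vec_eq_iff forall_4)
  qed
  have range_F: "range F \<subseteq> E" using FE by blast
  have "\<exists>d\<in>A. p \<in> fst d \<and> fst d \<subseteq> UNIV \<and> (\<forall>u\<in>chart_image d. ?\<Psi> (in_chart d F u) = u \<and> in_chart d F u \<in> E)"
    by (rule chart_of_ambient_functions[OF E sm open_UNIV UNIV_I range_F]) (rule inj)
  then obtain d where d: "d \<in> A" "p \<in> fst d" "\<And>u. u \<in> chart_image d \<Longrightarrow> ?\<Psi> (in_chart d F u) = u"
    "\<And>u. u \<in> chart_image d \<Longrightarrow> in_chart d F u \<in> E"
    by blast
  show ?thesis
  proof (rule that[OF d(1,2)])
    fix u assume u: "u \<in> chart_image d"
    have 1: "in_chart d F u $ 1 = u $ 1" "ln (\<rho> * in_chart d F u $ 3) = u $ 2" "in_chart d F u $ 2 = u $ 3"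
      using d(3)[OF u] by (metis vector_3)+
    have "exp (u $ 2) = \<rho> * in_chart d F u $ 3" using d(4)[OF u] 1(2) by (metis E_def exp_ln mem_Collect_eq)
    then have "\<rho> * exp (u $ 2) = (\<rho> * \<rho>) * in_chart d F u $ 3" by simp
    with 1 \<rho>(1) show "in_chart d F u $ 1 = u $ 1 \<and> in_chart d F u $ 3 = \<rho> * exp (u $ 2) \<and> in_chart d F u $ 2 = u $ 3"
      by simp
  qed
qed

text \<open>The image lies in the hyperplane cos \<theta> x_3 + sin \<theta> x_4 = K; solving for
  x_4 gives the slope - cot \<theta> and C = K / sin \<theta>. The differential equation is w = 0
  divided by cos \<theta>.\<close>

lemma oblique_case:
  assumes s: "s p0 \<noteq> 0" and c: "c p0 \<noteq> 0"
  shows "\<exists>\<theta> C \<rho>. \<rho> \<noteq> 0 \<and> sin \<theta> \<noteq> 0 \<and> cos \<theta> \<noteq> 0 \<and>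
    (\<forall>p. dH H 3 (F p) = - tan \<theta> * dH H 4 (F p)) \<and>
    (\<forall>p. \<exists>d\<in>A. p \<in> fst d \<and> (\<forall>u\<in>chart_image d.
       in_chart d F u = vector [u $ 1, u $ 3, \<rho> * exp (u $ 2), - cot \<theta> * \<rho> * exp (u $ 2) + C]))"
proof -
  obtain \<theta> where \<theta>: "c p0 = cos \<theta>" "s p0 = sin \<theta>" using c_s_angle by blast
  have cs: "c p = cos \<theta>" "s p = sin \<theta>" for p
    using \<theta> c_constant[of p p0] s_constant[of p p0] by simp_all
  have nz: "sin \<theta> \<noteq> 0" "cos \<theta> \<noteq> 0" using \<theta> s c by auto
  obtain \<rho> :: real where \<rho>: "\<rho> \<noteq> 0" "\<rho> * \<rho> = 1" "\<And>p. \<rho> * F p $ 3 > 0" by (rule F3_sign) blast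
  define K where "K = c p0 * F p0 $ 3 + s p0 * F p0 $ 4"
  have F4: "F p $ 4 = - cot \<theta> * F p $ 3 + K / sin \<theta>" for p
  proof -
    have "cos \<theta> * F p $ 3 + sin \<theta> * F p $ 4 = K"
      unfolding K_def using orthogonal_coordinate_constant[of p p0] by (simp add: cs)
    then show ?thesis using nz by (simp add: cot_def field_simps)
  qed
  have "dH H 3 (F p) = - tan \<theta> * dH H 4 (F p)" for p
    using adapted_facts(1)[of p] nz by (simp add: cs tan_def field_simps)
  moreover have "\<exists>d\<in>A. p \<in> fst d \<and> (\<forall>u\<in>chart_image d.
       in_chart d F u = vector [u $ 1, u $ 3, \<rho> * exp (u $ 2), - cot \<theta> * \<rho> * exp (u $ 2) + K / sin \<theta>])" for p
  proof -
    obtain d where d: "d \<in> A" "p \<in> fst d" "\<And>u. u \<in> chart_image d \<Longrightarrow>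
        in_chart d F u $ 1 = u $ 1 \<and> in_chart d F u $ 3 = \<rho> * exp (u $ 2) \<and> in_chart d F u $ 2 = u $ 3"
      using exponential_chart[of p \<rho>] nz \<rho> cs by metis
    have "in_chart d F u $ 4 = - cot \<theta> * in_chart d F u $ 3 + K / sin \<theta>" for u
      using F4 by (simp add: in_chart_def)
    then have "in_chart d F u = vector [u $ 1, u $ 3, \<rho> * exp (u $ 2), - cot \<theta> * \<rho> * exp (u $ 2) + K / sin \<theta>]"
      if "u \<in> chart_image d" for u
      using d(3)[OF that] by (simp add: vec_eq_iff forall_4 vector_4_component)
    then show ?thesis using d(1,2) by blast
  qed
  ultimately show ?thesis using \<rho>(1) nz by blast
qed

text \<open>With s = 0 and c nonzero the hyperplane is x_3 = C, and C inherits being nonzero from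
  x_3.\<close>

lemma vertical_case:
  assumes s: "s p0 = 0"
  shows "\<exists>C. C \<noteq> 0 \<and> (\<forall>p. ddH H 3 2 (F p) = 0 \<and> ddH H 3 4 (F p) = 0) \<and>
    (\<forall>p. \<exists>d\<in>A. p \<in> fst d \<and> (\<forall>u\<in>chart_image d. in_chart d F u = vector [u $ 1, u $ 3, C, u $ 2]))"
proof -
  have s: "s p = 0" for p using s s_constant[of p p0] by simp
  have c: "c p \<noteq> 0" for p using c_s_unit[of p] s by auto
  have F3_eq: "F p $ 3 = F p0 $ 3" for p
    using orthogonal_coordinate_constant[of p p0] c[of p0] c_constant[of p p0] by (simp add: s)
  have "\<exists>d\<in>A. p \<in> fst d \<and> (\<forall>u\<in>chart_image d. in_chart d F u = vector [u $ 1, u $ 3, F p0 $ 3, u $ 2])" for p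
  proof -
    obtain d where d: "d \<in> A" "p \<in> fst d" "\<And>u. u \<in> chart_image d \<Longrightarrow>
        in_chart d F u $ 1 = u $ 1 \<and> in_chart d F u $ 4 = u $ 2 \<and> in_chart d F u $ 2 = u $ 3"
      using adapted_chart[of 4 p] c by metis
    have "in_chart d F u $ 3 = F p0 $ 3" for u using F3_eq by (simp add: in_chart_def)
    then have "in_chart d F u = vector [u $ 1, u $ 3, F p0 $ 3, u $ 2]" if "u \<in> chart_image d" for u
      using d(3)[OF that] by (simp add: vec_eq_iff forall_4 vector_4_component)
    then show ?thesis using d(1,2) by blast
  qed
  then show ?thesis using F3[of p0] adapted_facts(2) s by blast
qed

end

theorem theorem4p2:
  fixes A :: "('m::{t2_space, second_countable_topology}, 3) chart set"
    and D :: "(real^4) set" and \<Lambda> \<beta> :: real and H :: "real \<Rightarrow> real \<Rightarrow> real \<Rightarrow> real"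
    and F \<xi> :: "'m \<Rightarrow> real^4" and a :: "'m \<Rightarrow> real"
  defines "g \<equiv> siklos_metric \<beta> H"
  assumes siklos: "siklos_spacetime D \<Lambda> \<beta> H"
    and manifold: "smooth_structure A" "connected (UNIV :: 'm set)"
    and hypersurface: "hypersurface A D g F \<xi>"
    and proper_parallel: "proper_parallel A g F \<xi>"
    and a_smooth: "smooth_map_on A UNIV a"
    and normal: "\<forall>p. \<exists>W \<theta>. open W \<and> p \<in> W \<and> smooth_map_on A W \<theta> \<and>
      (\<forall>q\<in>W. \<xi> q = a q *\<^sub>R axis 1 1 + (F q $ 3 / \<beta> * cos (\<theta> q)) *\<^sub>R axis 3 1
                   + (F q $ 3 / \<beta> * sin (\<theta> q)) *\<^sub>R axis 4 1 \<and>
         (ddH H 3 3 (F q) - ddH H 4 4 (F q)) * sin (2 * \<theta> q) = 2 * ddH H 3 4 (F q) * cos (2 * \<theta> q))"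
    and a_zero: "\<forall>p. a p = 0"
  shows "(\<exists>\<Phi>. ambient_isometry D g \<Phi> \<and>
      ((\<exists>\<theta> C \<rho>. \<rho> \<noteq> 0 \<and> sin \<theta> \<noteq> 0 \<and> cos \<theta> \<noteq> 0 \<and>
          (\<forall>p. dH H 3 (\<Phi> (F p)) = - tan \<theta> * dH H 4 (\<Phi> (F p))) \<and>
          (\<forall>p. \<exists>c\<in>A. p \<in> fst c \<and> (\<forall>u\<in>chart_image c.
             \<Phi> (in_chart c F u) =
               vector [u $ 1, u $ 3, \<rho> * exp (u $ 2), - cot \<theta> * \<rho> * exp (u $ 2) + C]))) \<or>
       (\<exists>C. C \<noteq> 0 \<and>
          (\<forall>p. ddH H 3 2 (\<Phi> (F p)) = 0 \<and> ddH H 3 4 (\<Phi> (F p)) = 0) \<and>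
          (\<forall>p. \<exists>c\<in>A. p \<in> fst c \<and> (\<forall>u\<in>chart_image c.
             \<Phi> (in_chart c F u) = vector [u $ 1, u $ 3, C, u $ 2])))))
    \<and> constant_mean_curvature A g F \<xi>"
proof -
  interpret siklos_hypersurface A D \<Lambda> \<beta> H F \<xi>
  proof
    show "parallel_hypersurface A (siklos_metric \<beta> H) F \<xi>"
      using proper_parallel by (simp add: proper_parallel_def g_def)
    fix p
    obtain W \<theta> where "p \<in> W" "\<forall>q\<in>W. \<xi> q = a q *\<^sub>R axis 1 1 + (F q $ 3 / \<beta> * cos (\<theta> q)) *\<^sub>R axis 3 1
                   + (F q $ 3 / \<beta> * sin (\<theta> q)) *\<^sub>R axis 4 1"
      using normal by meson
    then have "\<xi> p = (F p $ 3 / \<beta> * cos (\<theta> p)) *\<^sub>R axis 3 1 + (F p $ 3 / \<beta> * sin (\<theta> p)) *\<^sub>R axis 4 1"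
      using a_zero by simp
    then show "\<exists>\<theta>. \<xi> p = (F p $ 3 / \<beta> * cos \<theta>) *\<^sub>R axis 3 1 + (F p $ 3 / \<beta> * sin \<theta>) *\<^sub>R axis 4 1" by blast
  qed (use siklos manifold hypersurface in \<open>auto simp: g_def\<close>)
  \<comment> \<open>Properness enters here: a vanishing cosine would make the hypersurface totally
    geodesic.\<close>
  have "c undefined \<noteq> 0"
    using totally_geodesic_if_c_zero proper_parallel by (auto simp: proper_parallel_def g_def)
  then have "(\<exists>\<theta> C \<rho>. \<rho> \<noteq> 0 \<and> sin \<theta> \<noteq> 0 \<and> cos \<theta> \<noteq> 0 \<and>
          (\<forall>p. dH H 3 (F p) = - tan \<theta> * dH H 4 (F p)) \<and>
          (\<forall>p. \<exists>c\<in>A. p \<in> fst c \<and> (\<forall>u\<in>chart_image c.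
             in_chart c F u = vector [u $ 1, u $ 3, \<rho> * exp (u $ 2), - cot \<theta> * \<rho> * exp (u $ 2) + C]))) \<or>
       (\<exists>C. C \<noteq> 0 \<and> (\<forall>p. ddH H 3 2 (F p) = 0 \<and> ddH H 3 4 (F p) = 0) \<and>
          (\<forall>p. \<exists>c\<in>A. p \<in> fst c \<and> (\<forall>u\<in>chart_image c. in_chart c F u = vector [u $ 1, u $ 3, C, u $ 2])))"
    using oblique_case[of undefined] vertical_case[of undefined] by (cases "s undefined = 0") blast+
  moreover have "ambient_isometry D g (\<lambda>x. x)"
    by (rule ambient_isometry_id[OF siklos_open[OF siklos]])
  ultimately show ?thesis using constant_mean_curvature unfolding g_def by (intro conjI exI[of _ "\<lambda>x. x"])
qed

end
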